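(* Let the Finsler space $(M,F)$, $\dim M=N\ge3$, be conformally automorphic to the Riemannian space $(M,S)$ with constant degree $H$ through the transformation $t=t(x,y)$, and let $N^k{}_i=-y^k_h\left(\frac{\partial t^h}{\partial x^i}+a^h{}_{li}t^l\right)$, $D^k{}_{in}=-\partial N^k{}_i/\partial y^n$. Define $$M^n{}_{ij}=d_iN^n{}_j-d_jN^n{}_i,\qquad E_k{}^n{}_{ij}=d_iD^n{}_{jk}-d_jD^n{}_{ik}+D^m{}_{jk}D^n{}_{im}-D^m{}_{ik}D^n{}_{jm},$$ $$\rho_k{}^n{}_{ij}=E_k{}^n{}_{ij}-M^h{}_{ij}C^n{}_{hk},\qquad \rho_{knij}=g_{mn}\rho_k{}^m{}_{ij}.$$ Then: (1) $M^n{}_{ij}=-y^n_r\,t^h\,a_h{}^r{}_{ij}$; (2) $\displaystyle \rho_k{}^n{}_{ij}=-(1-H)\frac1F\left(l_k\delta^n_m-l^ng_{mk}\right)M^m{}_{ij}+y^n_m\,a_h{}^m{}_{ij}\,t^h_k$; (3) $\rho_{mnij}=-\rho_{nmij}=-\rho_{mnji}$; (4) the cyclic identity $\mathcal D_l\rho_k{}^n{}_{ij}+\mathcal D_j\rho_k{}^n{}_{li}+\mathcal D_i\rho_k{}^n{}_{jl}=0$ holds, where $$\mathcal D_l\rho_k{}^n{}_{ij}=d_l\rho_k{}^n{}_{ij}+D^n{}_{ls}\rho_k{}^s{}_{ij}-D^s{}_{lk}\rho_s{}^n{}_{ij}-a^s{}_{li}\rho_k{}^n{}_{sj}-a^s{}_{lj}\rho_k{}^n{}_{is};$$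 (5) $\displaystyle \rho^{knij}\rho_{knij}=a^{knij}a_{knij}+\frac2{S^2}\left(\frac1{H^2}-1\right)t^l a_l{}^{nij}\,t^ha_{hnij}$, where $S=S(x,t(x,y))$.
   Context: $M$ is a $C^\infty$ manifold with local coordinates $x^i$; $y^i$ are the induced coordinates of tangent vectors $y\in T_xM\setminus0$; repeated indices are summed over $1,\dots,N$; considerations are local. The Finsler metric function $F(x,y)$ is smooth, positive, positively homogeneous of degree 1 in $y$, with positive-definite metric tensor $g_{ij}=\frac12\,\partial^2F^2/\partial y^i\partial y^j$, inverse $g^{ij}$; $l^i=y^i/F$, $l_i=\partial F/\partial y^i$; $C^n{}_{hk}=\frac12g^{nm}\,\partial g_{mh}/\partial y^k$. $S(x,y)=\sqrt{a_{ij}(x)y^iy^j}$ is a Riemannian metric function, $a^i{}_{kn}(x)$ are the Christoffel symbols of $a_{ij}$, and $$a_n{}^i{}_{km}=\frac{\partial a^i{}_{nm}}{\partial x^k}-\frac{\partial a^i{}_{nk}}{\partial x^m}+a^u{}_{nm}a^i{}_{uk}-a^u{}_{nk}a^i{}_{um}$$ is the Riemannian curvature tensor; $a_{hlij}=a_{lr}a_h{}^r{}_{ij}$, and indices of this tensor are raised with $a^{ij}$. In $\rho^{knij}$ the first two indices of $\rho_{knij}$ are raised with $g^{ij}$ and the last two with $a^{ij}$. Definition. $(M,F)$ is conformally automorphic to $(M,S)$, of degree $H>0$, if there is a smooth family of invertible smooth transformations $y\mapsto t=t(x,y)$ of nonzero tangent vectors at $x$ into nonzero tangent vectors at the same $x$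 such that: (i) $t^m(x,ky)=k^{H}t^m(x,y)$ for all $k>0$; (ii) $F(x,y)=1\iff S(x,t(x,y))=1$; (iii) $g_{mn}(x,y)=p^2\,a_{ij}(x)\,t^i_m t^j_n$, where $t^i_m=\partial t^i/\partial y^m$ and $p=p(x,y)>0$. Notation: $y=y(x,t)$ is the inverse transformation and $y^k_i=\partial y^k/\partial t^i$, evaluated at $t=t(x,y)$; $d_i=\frac{\partial}{\partial x^i}+N^k{}_i\frac{\partial}{\partial y^k}$. *)

theory Defs
  imports "HOL-Analysis.Analysis"
begin

(* Everything is local: the manifold is an open set U of R^N with N = CARD('n), and a geometric
   object is given by its components as functions of the coordinates x, or of (x, y) with y a
   tangent vector at x.  Component functions take their indices first, in the printed
   left-to-right order whether upper or lower; e.g. riemann_curv a n i k m x is a_n^i_km(x). *)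

type_synonym 'n fibre_fun = "real^'n \<Rightarrow> real^'n \<Rightarrow> real"

primrec Ck_on :: "nat \<Rightarrow> 'a::euclidean_space set \<Rightarrow> ('a \<Rightarrow> 'b::real_normed_vector) \<Rightarrow> bool" where
  "Ck_on 0 U f \<longleftrightarrow> continuous_on U f"
| "Ck_on (Suc k) U f \<longleftrightarrow>
     (\<forall>x\<in>U. f differentiable (at x)) \<and> (\<forall>v. Ck_on k U (\<lambda>x. frechet_derivative f (at x) v))"

(* C-infinity on an open set *)
definition smooth_on :: "'a::euclidean_space set \<Rightarrow> ('a \<Rightarrow> 'b::real_normed_vector) \<Rightarrow> bool" where
  "smooth_on U f \<longleftrightarrow> (\<forall>k. Ck_on k U f)"

definition slit_bundle :: "(real^'n) set \<Rightarrow> ((real^'n) \<times> (real^'n)) set" where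
  "slit_bundle U = U \<times> (- {0})"

definition partial :: "'n \<Rightarrow> (real^'n \<Rightarrow> real) \<Rightarrow> real^'n \<Rightarrow> real" where
  "partial i f x = frechet_derivative f (at x) (axis i 1)"

definition pdx :: "('n::finite) \<Rightarrow> 'n fibre_fun \<Rightarrow> 'n fibre_fun" where
  "pdx i f x y = partial i (\<lambda>z. f z y) x"

definition pdy :: "('n::finite) \<Rightarrow> 'n fibre_fun \<Rightarrow> 'n fibre_fun" where
  "pdy i f x y = partial i (f x) y"

definition pos_def :: "real^'n^'n \<Rightarrow> bool" where
  "pos_def A \<longleftrightarrow> transpose A = A \<and> (\<forall>v. v \<noteq> 0 \<longrightarrow> v \<bullet> (A *v v) > 0)"


subsection \<open>Finsler metric functions\<close>

definition metric_tensor :: "'n fibre_fun \<Rightarrow> real^'n \<Rightarrow> real^'n \<Rightarrow> real^'n^'n" where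
  "metric_tensor F x y = (\<chi> i j. 1/2 * pdy i (pdy j (\<lambda>x y. (F x y)^2)) x y)"

definition finsler_metric :: "(real^'n) set \<Rightarrow> 'n fibre_fun \<Rightarrow> bool" where
  "finsler_metric U F \<longleftrightarrow>
     smooth_on (slit_bundle U) (\<lambda>(x, y). F x y) \<and>
     (\<forall>x\<in>U. \<forall>y. y \<noteq> 0 \<longrightarrow>
        F x y > 0 \<and> (\<forall>k>0. F x (k *\<^sub>R y) = k * F x y) \<and> pos_def (metric_tensor F x y))"

definition unit_vec :: "('n::finite) fibre_fun \<Rightarrow> 'n \<Rightarrow> 'n fibre_fun" where
  "unit_vec F i x y = y $ i / F x y"

definition unit_covec :: "('n::finite) fibre_fun \<Rightarrow> 'n \<Rightarrow> 'n fibre_fun" where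
  "unit_covec F i = pdy i F"

definition cartan_tensor :: "('n::finite) fibre_fun \<Rightarrow> 'n \<Rightarrow> 'n \<Rightarrow> 'n \<Rightarrow> 'n fibre_fun" where
  "cartan_tensor F n h k x y =
     1/2 * (\<Sum>m\<in>UNIV. matrix_inv (metric_tensor F x y) $ n $ m *
                     pdy k (\<lambda>x y. metric_tensor F x y $ m $ h) x y)"


subsection \<open>Riemannian metrics\<close>

definition riemannian_metric :: "(real^'n) set \<Rightarrow> (real^'n \<Rightarrow> real^'n^'n) \<Rightarrow> bool" where
  "riemannian_metric U a \<longleftrightarrow> smooth_on U a \<and> (\<forall>x\<in>U. pos_def (a x))"

definition riemannian_fun :: "(real^'n \<Rightarrow> real^'n^'n) \<Rightarrow> 'n fibre_fun" where
  "riemannian_fun a x y = sqrt (\<Sum>i\<in>UNIV. \<Sum>j\<in>UNIV. a x $ i $ j * y $ i * y $ j)"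

definition christoffel :: "(real^'n \<Rightarrow> real^'n^'n) \<Rightarrow> 'n \<Rightarrow> 'n \<Rightarrow> 'n \<Rightarrow> real^'n \<Rightarrow> real" where
  "christoffel a i k n x =
     1/2 * (\<Sum>m\<in>UNIV. matrix_inv (a x) $ i $ m *
        (partial k (\<lambda>z. a z $ m $ n) x + partial n (\<lambda>z. a z $ m $ k) x
          - partial m (\<lambda>z. a z $ k $ n) x))"

definition riemann_curv ::
  "(real^'n \<Rightarrow> real^'n^'n) \<Rightarrow> 'n \<Rightarrow> 'n \<Rightarrow> 'n \<Rightarrow> 'n \<Rightarrow> real^'n \<Rightarrow> real" where
  "riemann_curv a n i k m x =
     partial k (christoffel a i n m) x - partial m (christoffel a i n k) x
     + (\<Sum>u\<in>UNIV. christoffel a u n m x * christoffel a i u k x)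
     - (\<Sum>u\<in>UNIV. christoffel a u n k x * christoffel a i u m x)"

(* a_{hlij} *)
definition riemann_low ::
  "(real^'n \<Rightarrow> real^'n^'n) \<Rightarrow> 'n \<Rightarrow> 'n \<Rightarrow> 'n \<Rightarrow> 'n \<Rightarrow> real^'n \<Rightarrow> real" where
  "riemann_low a h l i j x = (\<Sum>r\<in>UNIV. a x $ l $ r * riemann_curv a h r i j x)"

(* a_l^{nij}: the last three indices raised *)
definition riemann_raise3 ::
  "(real^'n \<Rightarrow> real^'n^'n) \<Rightarrow> 'n \<Rightarrow> 'n \<Rightarrow> 'n \<Rightarrow> 'n \<Rightarrow> real^'n \<Rightarrow> real" where
  "riemann_raise3 a l n i j x =
     (\<Sum>q\<in>UNIV. \<Sum>r\<in>UNIV. \<Sum>s\<in>UNIV.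
        matrix_inv (a x) $ n $ q * matrix_inv (a x) $ i $ r * matrix_inv (a x) $ j $ s *
        riemann_low a l q r s x)"

(* a^{knij}: all four indices raised *)
definition riemann_raise4 ::
  "(real^'n \<Rightarrow> real^'n^'n) \<Rightarrow> 'n \<Rightarrow> 'n \<Rightarrow> 'n \<Rightarrow> 'n \<Rightarrow> real^'n \<Rightarrow> real" where
  "riemann_raise4 a k n i j x =
     (\<Sum>p\<in>UNIV. matrix_inv (a x) $ k $ p * riemann_raise3 a p n i j x)"


subsection \<open>Conformal automorphisms\<close>

(* t^i_m = dt^i/dy^m *)
definition jac :: "(real^'n \<Rightarrow> real^'n \<Rightarrow> real^'n) \<Rightarrow> 'n \<Rightarrow> 'n \<Rightarrow> 'n fibre_fun" where
  "jac t i m = pdy m (\<lambda>x y. t x y $ i)"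

(* y^k_i = dy^k/dt^i for the inverse y = y(x,t), as a function of (x,y) via t = t(x,y) *)
definition jac_inv :: "(real^'n \<Rightarrow> real^'n \<Rightarrow> real^'n) \<Rightarrow> 'n \<Rightarrow> 'n \<Rightarrow> 'n fibre_fun" where
  "jac_inv t k i x y = partial i (\<lambda>\<tau>. inv_into (- {0}) (t x) \<tau> $ k) (t x y)"

(* Smoothness of the inverse is not listed as a separate condition: the last clause and the
   positive definiteness of both metrics make the Jacobian of t nonsingular. *)
definition conformal_automorphism ::
  "(real^'n) set \<Rightarrow> 'n fibre_fun \<Rightarrow> (real^'n \<Rightarrow> real^'n^'n) \<Rightarrow> real \<Rightarrow>
   (real^'n \<Rightarrow> real^'n \<Rightarrow> real^'n) \<Rightarrow> bool" where
  "conformal_automorphism U F a H t \<longleftrightarrow>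
     H > 0 \<and>
     smooth_on (slit_bundle U) (\<lambda>(x, y). t x y) \<and>
     (\<forall>x\<in>U. bij_betw (t x) (- {0}) (- {0})) \<and>
     (\<forall>x\<in>U. \<forall>y. y \<noteq> 0 \<longrightarrow> (\<forall>k>0. t x (k *\<^sub>R y) = (k powr H) *\<^sub>R t x y)) \<and>
     (\<forall>x\<in>U. \<forall>y. y \<noteq> 0 \<longrightarrow> (F x y = 1 \<longleftrightarrow> riemannian_fun a x (t x y) = 1)) \<and>
     (\<exists>p. \<forall>x\<in>U. \<forall>y. y \<noteq> 0 \<longrightarrow> p x y > 0 \<and>
        (\<forall>m n. metric_tensor F x y $ m $ n =
           (p x y)^2 * (\<Sum>i\<in>UNIV. \<Sum>j\<in>UNIV. a x $ i $ j * jac t i m x y * jac t j n x y)))"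


subsection \<open>Connection and curvature\<close>

definition autom_conn ::
  "(real^'n \<Rightarrow> real^'n^'n) \<Rightarrow> (real^'n \<Rightarrow> real^'n \<Rightarrow> real^'n) \<Rightarrow> 'n \<Rightarrow> 'n \<Rightarrow> 'n fibre_fun" where
  "autom_conn a t k i x y =
     - (\<Sum>h\<in>UNIV. jac_inv t k h x y *
          (pdx i (\<lambda>x y. t x y $ h) x y + (\<Sum>l\<in>UNIV. christoffel a h l i x * t x y $ l)))"

(* In the following, N k i stands for N^k_i. *)

definition hor_deriv :: "(('n::finite) \<Rightarrow> 'n \<Rightarrow> 'n fibre_fun) \<Rightarrow> 'n \<Rightarrow> 'n fibre_fun \<Rightarrow> 'n fibre_fun" where
  "hor_deriv N i f x y = pdx i f x y + (\<Sum>k\<in>UNIV. N k i x y * pdy k f x y)"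

definition conn_coeff :: "(('n::finite) \<Rightarrow> 'n \<Rightarrow> 'n fibre_fun) \<Rightarrow> 'n \<Rightarrow> 'n \<Rightarrow> 'n \<Rightarrow> 'n fibre_fun" where
  "conn_coeff N k i n x y = - pdy n (N k i) x y"

definition M_curv :: "(('n::finite) \<Rightarrow> 'n \<Rightarrow> 'n fibre_fun) \<Rightarrow> 'n \<Rightarrow> 'n \<Rightarrow> 'n \<Rightarrow> 'n fibre_fun" where
  "M_curv N n i j x y = hor_deriv N i (N n j) x y - hor_deriv N j (N n i) x y"

definition E_curv :: "(('n::finite) \<Rightarrow> 'n \<Rightarrow> 'n fibre_fun) \<Rightarrow> 'n \<Rightarrow> 'n \<Rightarrow> 'n \<Rightarrow> 'n \<Rightarrow> 'n fibre_fun" where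
  "E_curv N k n i j x y =
     hor_deriv N i (conn_coeff N n j k) x y - hor_deriv N j (conn_coeff N n i k) x y
     + (\<Sum>m\<in>UNIV. conn_coeff N m j k x y * conn_coeff N n i m x y)
     - (\<Sum>m\<in>UNIV. conn_coeff N m i k x y * conn_coeff N n j m x y)"

definition rho_curv ::
  "('n::finite) fibre_fun \<Rightarrow> ('n \<Rightarrow> 'n \<Rightarrow> 'n fibre_fun) \<Rightarrow> 'n \<Rightarrow> 'n \<Rightarrow> 'n \<Rightarrow> 'n \<Rightarrow> 'n fibre_fun" where
  "rho_curv F N k n i j x y =
     E_curv N k n i j x y - (\<Sum>h\<in>UNIV. M_curv N h i j x y * cartan_tensor F n h k x y)"

(* rho_{knij} *)
definition rho_low ::
  "('n::finite) fibre_fun \<Rightarrow> ('n \<Rightarrow> 'n \<Rightarrow> 'n fibre_fun) \<Rightarrow> 'n \<Rightarrow> 'n \<Rightarrow> 'n \<Rightarrow> 'n \<Rightarrow> 'n fibre_fun" where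
  "rho_low F N k n i j x y =
     (\<Sum>m\<in>UNIV. metric_tensor F x y $ m $ n * rho_curv F N k m i j x y)"

(* rho^{knij}: the first two indices are raised with g, the last two with a *)
definition rho_raise ::
  "'n fibre_fun \<Rightarrow> (real^'n \<Rightarrow> real^'n^'n) \<Rightarrow> ('n \<Rightarrow> 'n \<Rightarrow> 'n fibre_fun) \<Rightarrow>
   'n \<Rightarrow> 'n \<Rightarrow> 'n \<Rightarrow> 'n \<Rightarrow> 'n fibre_fun" where
  "rho_raise F a N k n i j x y =
     (\<Sum>p\<in>UNIV. \<Sum>q\<in>UNIV. \<Sum>r\<in>UNIV. \<Sum>s\<in>UNIV.
        matrix_inv (metric_tensor F x y) $ k $ p * matrix_inv (metric_tensor F x y) $ n $ q *
        matrix_inv (a x) $ i $ r * matrix_inv (a x) $ j $ s * rho_low F N p q r s x y)"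

(* cov_deriv a N l T k n i j is the covariant derivative D_l T_k^n_ij: the vector-bundle indices
   k, n are transported by the coefficients of N, the form indices i, j by those of a. *)
definition cov_deriv ::
  "(real^'n \<Rightarrow> real^'n^'n) \<Rightarrow> ('n \<Rightarrow> 'n \<Rightarrow> 'n fibre_fun) \<Rightarrow> 'n \<Rightarrow>
   ('n \<Rightarrow> 'n \<Rightarrow> 'n \<Rightarrow> 'n \<Rightarrow> 'n fibre_fun) \<Rightarrow> 'n \<Rightarrow> 'n \<Rightarrow> 'n \<Rightarrow> 'n \<Rightarrow> 'n fibre_fun" where
  "cov_deriv a N l T k n i j x y =
     hor_deriv N l (T k n i j) x y
     + (\<Sum>s\<in>UNIV. conn_coeff N n l s x y * T k s i j x y)
     - (\<Sum>s\<in>UNIV. conn_coeff N s l k x y * T s n i j x y)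
     - (\<Sum>s\<in>UNIV. christoffel a s l i x * T k n s j x y)
     - (\<Sum>s\<in>UNIV. christoffel a s l j x * T k n i s x y)"

end

(* Write A, J, \<Gamma>_i, R_ij for the matrices of a, of the Jacobian of t, of the Christoffel symbols
   and of the curvature of a; let B be the inverse of J and \<sigma> = S^2(x, t) = t.At. The coefficients
   N are chosen such that d_i t = - \<Gamma>_i t. Applying the commutator [d_i, d_j] = M^n_ij d/dy^n to t
   gives M_ij = - B R_ij t, and E is minus the fibre derivative of M. Contracting the conformality
   relation with y shows p^2 = F^2 / (H^2 \<sigma>), so the total symmetry of the Cartan tensor expresses it
   through the second fibre derivatives of t, which yields the formula for \<rho>. Rewriting it as

     \<rho>_ij = B Q_ij J,   Q_ij = R_ij + (1 - H) / (H \<sigma>) (R_ij P + P R_ij),   P = t t^T A,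

   the rest happens on the Riemannian side: B, J, P and \<sigma> are parallel, so the cyclic identity is
   the Bianchi identity of a; A Q_ij is skew because A R_ij is and A P is symmetric; and the
   contraction of \<rho> with itself is - tr (Q_rs Q_ij), where P^2 = \<sigma> P and P R P = 0. *)

theory Submission
  imports Defs
begin

subsection \<open>Iterated differentiability\<close>

text \<open>The correction \<open>M C\<close> in \<rho> removes the second fibre derivatives of t:
  differentiating \<open>J M = - R t\<close> leaves a term with the derivative of J in E, and the
  Cartan tensor contributes the same term. What remains is algebraic in R, J and t.

  The shape of Q has a reason. Since \<open>P R P = 0\<close>, Q equals
  \<open>(1 + \<kappa> P) R (1 + \<kappa> P)\<close> with
  \<open>\<kappa> = (1 - H) / (H \<sigma>)\<close>, and the outer factor stretches t by
  \<open>1 + \<kappa> \<sigma> = 1 / H\<close> while it fixes the a-orthogonal complement of t. This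
  is the origin of \<open>1 / H^2 - 1\<close> in the quadratic invariant.

  The technical obstacle is that derivatives are choice terms applied to curried functions whose
  values off the slit bundle are arbitrary. They are therefore treated axiomatically, as functionals
  that obey the Leibniz rule and see only values on the slit bundle; partial derivatives, horizontal
  derivatives and their entrywise versions for matrices then share one set of rules.\<close>

lemma Ck_on_cong:
  assumes "open W" "\<And>z. z \<in> W \<Longrightarrow> f z = g z" "Ck_on k W f"
  shows "Ck_on k W g"
  using assms(2,3)
proof (induction k arbitrary: f g)
  case 0
  then show ?case by (simp cong: continuous_on_cong)
next
  case (Suc k)
  have D: "(g has_derivative frechet_derivative f (at z)) (at z)" if "z \<in> W" for z
  proof (rule has_derivative_transform_within_open[OF _ assms(1) that])
    show "(f has_derivative frechet_derivative f (at z)) (at z)"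
      using Suc.prems(2) that by (simp flip: frechet_derivative_works)
  qed (use Suc.prems(1) in auto)
  then have eq: "frechet_derivative g (at z) = frechet_derivative f (at z)" if "z \<in> W" for z
    using frechet_derivative_at that by metis
  show ?case
  proof (simp, intro conjI ballI allI)
    show "g differentiable at z" if "z \<in> W" for z
      using D that by (auto simp: differentiable_def)
    show "Ck_on k W (\<lambda>z. frechet_derivative g (at z) v)" for v
    proof (rule Suc.IH)
      show "Ck_on k W (\<lambda>z. frechet_derivative f (at z) v)"
        using Suc.prems(2) by simp
    qed (simp add: eq)
  qed
qed

text \<open>Lets an explicit derivative \<open>D\<close> stand in for the choice term
  \<open>frechet_derivative\<close>; the closure properties below exhibit such a \<open>D\<close>
  and then treat it at order \<open>k\<close>.\<close>

lemma Ck_on_SucI: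
  assumes "open W" "\<And>z. z \<in> W \<Longrightarrow> (f has_derivative D z) (at z)" "\<And>v. Ck_on k W (\<lambda>z. D z v)"
  shows "Ck_on (Suc k) W f"
proof (simp, intro conjI ballI allI)
  show "f differentiable at z" if "z \<in> W" for z
    using assms(2) that by (auto simp: differentiable_def)
  have "D z v = frechet_derivative f (at z) v" if "z \<in> W" for z v
    using frechet_derivative_at[OF assms(2)[OF that]] by simp
  then show "Ck_on k W (\<lambda>z. frechet_derivative f (at z) v)" for v
    by (rule Ck_on_cong[OF assms(1) _ assms(3)])
qed

lemma Ck_on_has_derivative:
  assumes "Ck_on (Suc k) W f" "z \<in> W"
  shows "(f has_derivative frechet_derivative f (at z)) (at z)"
  using assms by (simp flip: frechet_derivative_works)

lemma Ck_on_SucD: "Ck_on (Suc k) W f \<Longrightarrow> Ck_on k W f"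
proof (induction k arbitrary: f)
  case 0
  then show ?case
    by (auto intro: continuous_at_imp_continuous_on differentiable_imp_continuous_within)
qed (metis Ck_on.simps(2))

lemma Ck_on_const: "Ck_on k W (\<lambda>z. c)"
  by (induction k arbitrary: c) auto

lemma Ck_on_bounded_linear:
  assumes "open W" "bounded_linear L"
  shows "Ck_on k W L"
proof (cases k)
  case 0
  then show ?thesis
    using linear_continuous_on[OF assms(2)] by simp
next
  case (Suc k)
  then show ?thesis
    using Ck_on_SucI[OF assms(1), of L "\<lambda>z. L"] bounded_linear.has_derivative[OF assms(2)]
    by (simp add: Ck_on_const bounded_linear_imp_has_derivative[OF assms(2)])
qed

lemma Ck_on_linear:
  assumes "open W" "bounded_linear L" "Ck_on k W f"
  shows "Ck_on k W (\<lambda>z. L (f z))"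
  using assms(3)
proof (induction k arbitrary: f)
  case 0
  then show ?case
    using bounded_linear.continuous_on[OF assms(2)] by auto
next
  case (Suc k)
  show ?case
  proof (rule Ck_on_SucI[OF assms(1)])
    show "((\<lambda>z. L (f z)) has_derivative (\<lambda>v. L (frechet_derivative f (at z) v))) (at z)"
      if "z \<in> W" for z
      using bounded_linear.has_derivative[OF assms(2) Ck_on_has_derivative[OF Suc.prems that]] .
    show "Ck_on k W (\<lambda>z. L (frechet_derivative f (at z) v))" for v
      using Suc by auto
  qed
qed

lemma Ck_on_fst:
  assumes "open U" "open V" "Ck_on k U f"
  shows "Ck_on k (U \<times> V) (\<lambda>z. f (fst z))"
  using assms(3)
proof (induction k arbitrary: f)
  case 0
  have "continuous_on (U \<times> V) (f \<circ> fst)"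
  proof (rule continuous_on_compose)
    show "continuous_on (fst ` (U \<times> V)) f"
      using 0 by (auto intro: continuous_on_subset)
  qed (intro continuous_intros)
  then show ?case by (simp add: o_def)
next
  case (Suc k)
  show ?case
  proof (rule Ck_on_SucI)
    show "((\<lambda>z. f (fst z)) has_derivative (\<lambda>v. frechet_derivative f (at (fst z)) (fst v))) (at z)"
      if "z \<in> U \<times> V" for z
    proof -
      have "((f \<circ> fst) has_derivative (frechet_derivative f (at (fst z)) \<circ> fst)) (at z)"
      proof (rule diff_chain_at)
        show "(fst has_derivative fst) (at z)"
          by (auto intro!: derivative_eq_intros)
        show "(f has_derivative frechet_derivative f (at (fst z))) (at (fst z))"
          using Ck_on_has_derivative[OF Suc.prems] that by auto
      qed
      then show ?thesis by (simp add: o_def)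
    qed
    show "Ck_on k (U \<times> V) (\<lambda>z. frechet_derivative f (at (fst z)) (fst v))" for v
      using Suc by auto
  qed (intro open_Times assms)
qed

lemma Ck_on_add:
  assumes "open W" "Ck_on k W f" "Ck_on k W g"
  shows "Ck_on k W (\<lambda>z. f z + g z)"
  using assms(2,3)
proof (induction k arbitrary: f g)
  case 0
  then show ?case by (auto intro: continuous_intros)
next
  case (Suc k)
  show ?case
  proof (rule Ck_on_SucI[OF assms(1)])
    show "((\<lambda>z. f z + g z) has_derivative
        (\<lambda>v. frechet_derivative f (at z) v + frechet_derivative g (at z) v)) (at z)"
      if "z \<in> W" for z
      using Suc.prems[THEN Ck_on_has_derivative, OF that] by (intro has_derivative_add)
  qed (use Suc in auto)
qed

lemma Ck_on_mult:
  fixes f g :: "'a::euclidean_space \<Rightarrow> real"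
  assumes "open W" "Ck_on k W f" "Ck_on k W g"
  shows "Ck_on k W (\<lambda>z. f z * g z)"
  using assms(2,3)
proof (induction k arbitrary: f g)
  case 0
  then show ?case by (auto intro: continuous_intros)
next
  case (Suc k)
  show ?case
  proof (rule Ck_on_SucI[OF assms(1)])
    show "((\<lambda>z. f z * g z) has_derivative
        (\<lambda>v. f z * frechet_derivative g (at z) v + frechet_derivative f (at z) v * g z)) (at z)"
      if "z \<in> W" for z
      using Suc.prems[THEN Ck_on_has_derivative, OF that] by (intro has_derivative_mult)
    show "Ck_on k W (\<lambda>z. f z * frechet_derivative g (at z) v + frechet_derivative f (at z) v * g z)"
      for v
      \<comment> \<open>The product rule leaves \<open>f\<close> and \<open>g\<close>
        undifferentiated, so the induction hypothesis is also applied to them, at the lower order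
        \<open>k\<close>.\<close>
      using Suc.prems Suc.prems[THEN Ck_on_SucD]
      by (intro Ck_on_add assms(1) Suc.IH) auto
  qed
qed

text \<open>The derivative of \<open>inverse f\<close> is again a product of
  \<open>inverse f\<close> and a derivative of \<open>f\<close>, so the induction runs on
  \<open>k\<close> with \<open>f\<close> fixed.\<close>

lemma Ck_on_inverse:
  fixes f :: "'a::euclidean_space \<Rightarrow> real"
  assumes "open W" "Ck_on k W f" "\<And>z. z \<in> W \<Longrightarrow> f z \<noteq> 0"
  shows "Ck_on k W (\<lambda>z. inverse (f z))"
  using assms(2)
proof (induction k)
  case 0
  then show ?case using assms(3) by (auto intro!: continuous_intros)
next
  case (Suc k)
  show ?case
  proof (rule Ck_on_SucI[OF assms(1)])
    show "((\<lambda>z. inverse (f z)) has_derivative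
        (\<lambda>v. - (inverse (f z) * frechet_derivative f (at z) v * inverse (f z)))) (at z)"
      if "z \<in> W" for z
      using assms(3)[OF that] Ck_on_has_derivative[OF Suc.prems that]
      by (rule Deriv.has_derivative_inverse)
    have "Ck_on k W (\<lambda>z. - 1 * (inverse (f z) * frechet_derivative f (at z) v * inverse (f z)))" for v
      using Suc Suc.prems[THEN Ck_on_SucD]
      by (intro Ck_on_mult assms(1) Ck_on_const) auto
    then show "Ck_on k W (\<lambda>z. - (inverse (f z) * frechet_derivative f (at z) v * inverse (f z)))" for v
      by simp
  qed
qed

section \<open>Symmetry of mixed second derivatives\<close>

lemma directional_mvt:
  fixes f :: "'a::real_normed_vector \<Rightarrow> real"
  assumes "0 < h" "\<And>s. 0 \<le> s \<Longrightarrow> s \<le> h \<Longrightarrow> (f has_derivative D (z + s *\<^sub>R u)) (at (z + s *\<^sub>R u))"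
  obtains s where "0 < s" "s < h" "f (z + h *\<^sub>R u) - f z = h * D (z + s *\<^sub>R u) u"
proof -
  have "((\<lambda>s. f (z + s *\<^sub>R u)) has_derivative (\<lambda>r. r * D (z + s *\<^sub>R u) u)) (at s within {0..h})"
    if "s \<in> {0..h}" for s
  proof -
    have d: "(f has_derivative D (z + s *\<^sub>R u)) (at (z + s *\<^sub>R u))"
      using assms(2) that by auto
    have "((\<lambda>s. z + s *\<^sub>R u) has_derivative (\<lambda>r. r *\<^sub>R u)) (at s)"
      by (auto intro!: derivative_eq_intros)
    then have "(f \<circ> (\<lambda>s. z + s *\<^sub>R u) has_derivative D (z + s *\<^sub>R u) \<circ> (\<lambda>r. r *\<^sub>R u)) (at s)"
      using d by (rule diff_chain_at)
    then show ?thesis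
      using linear_cmul[OF has_derivative_linear[OF d]]
      by (simp add: o_def has_derivative_at_withinI)
  qed
  from mvt_simple[OF assms(1) this] show ?thesis
    using that by force
qed

text \<open>Both mixed derivatives are limits of the same second difference quotient, by applying the
  mean value theorem twice in either order.\<close>

lemma second_difference_mvt:
  fixes f :: "'a::euclidean_space \<Rightarrow> real"
  assumes W: "open W" and C: "Ck_on 2 W f" and "0 < h"
    and sub: "\<And>s r. 0 \<le> s \<Longrightarrow> s \<le> h \<Longrightarrow> 0 \<le> r \<Longrightarrow> r \<le> h \<Longrightarrow> z + s *\<^sub>R u + r *\<^sub>R v \<in> W"
  obtains s r where "0 < s" "s < h" "0 < r" "r < h"
    "f (z + h *\<^sub>R u + h *\<^sub>R v) - f (z + h *\<^sub>R u) - f (z + h *\<^sub>R v) + f z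
      = h\<^sup>2 * frechet_derivative (\<lambda>z. frechet_derivative f (at z) u) (at (z + s *\<^sub>R u + r *\<^sub>R v)) v"
proof -
  have C': "Ck_on (Suc (Suc 0)) W f" using C by (simp add: numeral_2_eq_2)
  note df = Ck_on_has_derivative[OF C']
  have "Ck_on (Suc 0) W (\<lambda>z. frechet_derivative f (at z) u)" using C' by simp
  note ddf = Ck_on_has_derivative[OF this]
  let ?D = "\<lambda>z. frechet_derivative f (at z)"
  \<comment> \<open>The mean value theorem is applied to the increment of \<open>f\<close> along
    \<open>h v\<close>, not to \<open>f\<close>: the difference of this increment over
    \<open>h u\<close> is the second difference.\<close>
  obtain s where s: "0 < s" "s < h"
    "(f (z + h *\<^sub>R u + h *\<^sub>R v) - f (z + h *\<^sub>R u)) - (f (z + h *\<^sub>R v) - f z)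
      = h * (?D (z + s *\<^sub>R u + h *\<^sub>R v) u - ?D (z + s *\<^sub>R u) u)"
  proof (rule directional_mvt[OF \<open>0 < h\<close>, where f = "\<lambda>z. f (z + h *\<^sub>R v) - f z" and z = z and u = u
        and D = "\<lambda>z w. ?D (z + h *\<^sub>R v) w - ?D z w"])
    fix s assume "0 \<le> s" "s \<le> h"
    then have in1: "z + s *\<^sub>R u + h *\<^sub>R v \<in> W" and in2: "z + s *\<^sub>R u \<in> W"
      using sub[of s h] sub[of s 0] \<open>0 < h\<close> by auto
    have "((\<lambda>z. z + h *\<^sub>R v) has_derivative (\<lambda>w. w)) (at (z + s *\<^sub>R u))"
      by (auto intro!: derivative_eq_intros)
    from diff_chain_at[OF this df[OF in1]]
    have "((\<lambda>z. f (z + h *\<^sub>R v)) has_derivative ?D (z + s *\<^sub>R u + h *\<^sub>R v)) (at (z + s *\<^sub>R u))"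
      by (simp add: o_def)
    then show "((\<lambda>z. f (z + h *\<^sub>R v) - f z) has_derivative
        (\<lambda>w. ?D (z + s *\<^sub>R u + h *\<^sub>R v) w - ?D (z + s *\<^sub>R u) w)) (at (z + s *\<^sub>R u))"
      using df[OF in2] by (rule has_derivative_diff)
  qed (rule that)
  obtain r where r: "0 < r" "r < h"
    "?D (z + s *\<^sub>R u + h *\<^sub>R v) u - ?D (z + s *\<^sub>R u) u
      = h * frechet_derivative (\<lambda>z. ?D z u) (at (z + s *\<^sub>R u + r *\<^sub>R v)) v"
  proof (rule directional_mvt[OF \<open>0 < h\<close>, where f = "\<lambda>z. ?D z u" and z = "z + s *\<^sub>R u" and u = v
        and D = "\<lambda>z. frechet_derivative (\<lambda>z. ?D z u) (at z)"])
    fix r assume "0 \<le> r" "r \<le> h"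
    then show "((\<lambda>z. ?D z u) has_derivative frechet_derivative (\<lambda>z. ?D z u)
        (at (z + s *\<^sub>R u + r *\<^sub>R v))) (at (z + s *\<^sub>R u + r *\<^sub>R v))"
      using s sub[of s r] by (intro ddf) auto
  qed (rule that)
  show ?thesis
    by (rule that[OF s(1,2) r(1,2)]) (use s(3) r(3) in \<open>simp add: power2_eq_square\<close>)
qed

lemma mixed_derivatives_commute:
  fixes f :: "'a::euclidean_space \<Rightarrow> real"
  assumes W: "open W" and C: "Ck_on 2 W f" and z: "z \<in> W"
  shows "frechet_derivative (\<lambda>z. frechet_derivative f (at z) u) (at z) v
    = frechet_derivative (\<lambda>z. frechet_derivative f (at z) v) (at z) u"
proof (rule ccontr)
  define P where "P u v z = frechet_derivative (\<lambda>z. frechet_derivative f (at z) u) (at z) v" for u v z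
  assume "\<not> ?thesis"
  then have ne: "P u v z \<noteq> P v u z" by (simp add: P_def)
  \<comment> \<open>Half the supposed gap: near \<open>z\<close> the two mixed derivatives attain a
    common value, which would lie within \<open>e\<close> of both limits.\<close>
  define e where "e = \<bar>P u v z - P v u z\<bar> / 2"
  have "e > 0" using ne by (simp add: e_def)
  have cont: "continuous_on W (P u v)" for u v
    using C by (simp add: numeral_2_eq_2 P_def[abs_def])
  have ex: "\<exists>d>0. \<forall>w. dist w z < d \<longrightarrow> dist (P u v w) (P u v z) < e" for u v
    using continuous_on_interior[OF cont] z \<open>e > 0\<close> W
    by (fastforce simp: continuous_at_eps_delta interior_open)
  obtain d1 where d1: "d1 > 0" "\<And>w. dist w z < d1 \<Longrightarrow> dist (P u v w) (P u v z) < e"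
    using ex by blast
  obtain d2 where d2: "d2 > 0" "\<And>w. dist w z < d2 \<Longrightarrow> dist (P v u w) (P v u z) < e"
    using ex by blast
  obtain d3 where d3: "d3 > 0" "ball z d3 \<subseteq> W"
    using W z open_contains_ball by blast
  define d where "d = min d1 (min d2 d3)"
  have "d > 0" using d1 d2 d3 by (simp add: d_def)
  \<comment> \<open>This step size keeps the parallelogram spanned by \<open>h u\<close> and
    \<open>h v\<close> strictly inside the ball of radius \<open>d\<close>; the summand 1 also
    covers \<open>u = v = 0\<close>.\<close>
  define h where "h = d / (norm u + norm v + 1)"
  have pos: "norm u + norm v + 1 > 0" by (simp add: add_nonneg_pos)
  have "h > 0" using \<open>d > 0\<close> pos by (simp add: h_def)
  have near: "dist (z + s *\<^sub>R u + r *\<^sub>R v) z < d" if "0 \<le> s" "s \<le> h" "0 \<le> r" "r \<le> h" for s r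
  proof -
    have "dist (z + s *\<^sub>R u + r *\<^sub>R v) z = norm (s *\<^sub>R u + r *\<^sub>R v)"
      by (simp add: dist_norm add.assoc)
    also have "\<dots> \<le> s * norm u + r * norm v"
      using that by (intro norm_triangle_le) auto
    also have "\<dots> \<le> h * norm u + h * norm v"
      using that by (intro add_mono mult_right_mono) auto
    also have "\<dots> < h * (norm u + norm v + 1)" using \<open>h > 0\<close> by (simp add: algebra_simps)
    also have "\<dots> = d" using pos by (simp add: h_def)
    finally show ?thesis .
  qed
  then have sub: "z + s *\<^sub>R u + r *\<^sub>R v \<in> W" if "0 \<le> s" "s \<le> h" "0 \<le> r" "r \<le> h" for s r
    using that d3 by (force simp: d_def dist_commute)
  have sub': "z + s *\<^sub>R v + r *\<^sub>R u \<in> W" if "0 \<le> s" "s \<le> h" "0 \<le> r" "r \<le> h" for s r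
    using sub[of r s] that by (simp add: add_ac)
  obtain s r where sr: "0 < s" "s < h" "0 < r" "r < h"
    "f (z + h *\<^sub>R u + h *\<^sub>R v) - f (z + h *\<^sub>R u) - f (z + h *\<^sub>R v) + f z
      = h\<^sup>2 * P u v (z + s *\<^sub>R u + r *\<^sub>R v)"
    unfolding P_def by (rule second_difference_mvt[OF W C \<open>h > 0\<close> sub])
  obtain s' r' where sr': "0 < s'" "s' < h" "0 < r'" "r' < h"
    "f (z + h *\<^sub>R v + h *\<^sub>R u) - f (z + h *\<^sub>R v) - f (z + h *\<^sub>R u) + f z
      = h\<^sup>2 * P v u (z + s' *\<^sub>R v + r' *\<^sub>R u)"
    unfolding P_def by (rule second_difference_mvt[OF W C \<open>h > 0\<close> sub'])
  have "h\<^sup>2 * P u v (z + s *\<^sub>R u + r *\<^sub>R v) = h\<^sup>2 * P v u (z + s' *\<^sub>R v + r' *\<^sub>R u)"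
    unfolding sr(5)[symmetric] sr'(5)[symmetric] by (simp add: algebra_simps)
  then have "P u v (z + s *\<^sub>R u + r *\<^sub>R v) = P v u (z + s' *\<^sub>R v + r' *\<^sub>R u)"
    using \<open>h > 0\<close> by simp
  moreover have "dist (P u v (z + s *\<^sub>R u + r *\<^sub>R v)) (P u v z) < e"
    using near[of s r] sr by (intro d1) (auto simp: d_def)
  moreover have "dist (P v u (z + s' *\<^sub>R v + r' *\<^sub>R u)) (P v u z) < e"
    using near[of r' s'] sr' by (intro d2) (auto simp: d_def add_ac)
  ultimately have "dist (P u v z) (P v u z) < e + e"
    by (metis dist_commute dist_triangle_lt add_strict_mono)
  then show False
    by (simp add: dist_real_def e_def)
qed

subsection \<open>Derivations of smooth functions on the slit tangent bundle\<close>

locale slit_calculus =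
  fixes U :: "(real^'n) set"
  assumes open_base: "open U"
begin

definition sm :: "'n fibre_fun \<Rightarrow> bool" where
  "sm f \<longleftrightarrow> smooth_on (slit_bundle U) (\<lambda>(x, y). f x y)"

lemma open_slit_bundle: "open (slit_bundle U)"
  unfolding slit_bundle_def using open_base by (intro open_Times) auto

lemma mem_slit_bundle: "(x, y) \<in> slit_bundle U \<longleftrightarrow> x \<in> U \<and> y \<noteq> 0"
  by (simp add: slit_bundle_def)

lemma sm_cong:
  assumes "sm f" "\<And>x y. x \<in> U \<Longrightarrow> y \<noteq> 0 \<Longrightarrow> f x y = g x y"
  shows "sm g"
  unfolding sm_def smooth_on_def
proof
  fix k
  show "Ck_on k (slit_bundle U) (\<lambda>(x, y). g x y)"
  proof (rule Ck_on_cong[OF open_slit_bundle])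
    show "Ck_on k (slit_bundle U) (\<lambda>(x, y). f x y)"
      using assms(1) by (simp add: sm_def smooth_on_def)
  qed (use assms(2) in \<open>auto simp: mem_slit_bundle\<close>)
qed

lemma sm_const [intro]: "sm (\<lambda>x y. c)"
  by (simp add: sm_def smooth_on_def Ck_on_const case_prod_unfold)

lemma sm_add [intro]: "sm f \<Longrightarrow> sm g \<Longrightarrow> sm (\<lambda>x y. f x y + g x y)"
  by (simp add: sm_def smooth_on_def Ck_on_add open_slit_bundle case_prod_unfold)

lemma sm_mult [intro]: "sm f \<Longrightarrow> sm g \<Longrightarrow> sm (\<lambda>x y. f x y * g x y)"
  by (simp add: sm_def smooth_on_def Ck_on_mult open_slit_bundle case_prod_unfold)

lemma sm_uminus [intro]: "sm f \<Longrightarrow> sm (\<lambda>x y. - f x y)"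
  using sm_mult[OF sm_const[of "-1"], of f] by simp

lemma sm_diff [intro]: "sm f \<Longrightarrow> sm g \<Longrightarrow> sm (\<lambda>x y. f x y - g x y)"
  using sm_add[OF _ sm_uminus, of f g] by simp

lemma sm_sum [intro]: "(\<And>i. i \<in> I \<Longrightarrow> sm (f i)) \<Longrightarrow> sm (\<lambda>x y. \<Sum>i\<in>I. f i x y)"
  by (induction I rule: infinite_finite_induct) auto

lemma sm_prod [intro]: "(\<And>i. i \<in> I \<Longrightarrow> sm (f i)) \<Longrightarrow> sm (\<lambda>x y. \<Prod>i\<in>I. f i x y)"
  by (induction I rule: infinite_finite_induct) auto

lemma sm_divide [intro]:
  assumes "sm f" "sm g" "\<And>x y. x \<in> U \<Longrightarrow> y \<noteq> 0 \<Longrightarrow> g x y \<noteq> 0"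
  shows "sm (\<lambda>x y. f x y / g x y)"
proof -
  have "sm (\<lambda>x y. inverse (g x y))"
    unfolding sm_def smooth_on_def case_prod_unfold
    using assms(2,3) by (auto simp: sm_def smooth_on_def case_prod_unfold slit_bundle_def
        intro!: Ck_on_inverse open_slit_bundle[unfolded slit_bundle_def])
  then show ?thesis
    using sm_mult[OF assms(1)] by (simp add: divide_inverse)
qed

lemma sm_base:
  assumes "smooth_on U f"
  shows "sm (\<lambda>x y. f x)"
  using assms open_base unfolding sm_def smooth_on_def slit_bundle_def
  by (auto simp: case_prod_unfold intro!: Ck_on_fst)

lemma sm_component:
  fixes v :: "real^'n \<Rightarrow> real^'n \<Rightarrow> real^'n"
  assumes "smooth_on (slit_bundle U) (\<lambda>(x, y). v x y)"
  shows "sm (\<lambda>x y. v x y $ i)"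
  using assms Ck_on_linear[OF open_slit_bundle bounded_linear_vec_nth, of _ "\<lambda>(x, y). v x y" i]
  by (simp add: sm_def smooth_on_def case_prod_unfold)

section \<open>Directional derivatives, and derivations as their common abstraction\<close>

definition dd :: "(real^'n) \<times> (real^'n) \<Rightarrow> 'n fibre_fun \<Rightarrow> 'n fibre_fun" where
  "dd u f x y = frechet_derivative (\<lambda>(x, y). f x y) (at (x, y)) u"

lemma sm_has_derivative:
  assumes "sm f" "x \<in> U" "y \<noteq> 0"
  shows "((\<lambda>(x, y). f x y) has_derivative (\<lambda>u. dd u f x y)) (at (x, y))"
proof -
  have "Ck_on (Suc 0) (slit_bundle U) (\<lambda>(x, y). f x y)"
    using assms(1) by (simp only: sm_def smooth_on_def)
  from Ck_on_has_derivative[OF this, of "(x, y)"] show ?thesis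
    using assms(2,3) by (simp add: mem_slit_bundle dd_def[abs_def])
qed

lemma sm_dd: "sm f \<Longrightarrow> sm (dd u f)"
  unfolding sm_def smooth_on_def
proof
  fix k assume "\<forall>k. Ck_on k (slit_bundle U) (\<lambda>(x, y). f x y)"
  then have "Ck_on (Suc k) (slit_bundle U) (\<lambda>(x, y). f x y)" by blast
  then show "Ck_on k (slit_bundle U) (\<lambda>(x, y). dd u f x y)"
    by (cases u) (simp add: dd_def case_prod_unfold)
qed

lemma has_derivative_dd:
  assumes "((\<lambda>(x, y). f x y) has_derivative D) (at (x, y))"
  shows "dd u f x y = D u"
  using frechet_derivative_at[OF assms] by (simp add: dd_def)

lemma dd_cong:
  assumes "sm f" "\<And>x y. x \<in> U \<Longrightarrow> y \<noteq> 0 \<Longrightarrow> f x y = g x y" "x \<in> U" "y \<noteq> 0"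
  shows "dd u f x y = dd u g x y"
proof -
  have "((\<lambda>(x, y). g x y) has_derivative (\<lambda>u. dd u f x y)) (at (x, y))"
    by (rule has_derivative_transform_within_open[OF sm_has_derivative open_slit_bundle])
      (use assms in \<open>auto simp: mem_slit_bundle\<close>)
  then show ?thesis by (simp add: has_derivative_dd)
qed

lemma dd_commute:
  assumes "sm f" "x \<in> U" "y \<noteq> 0"
  shows "dd u (dd v f) x y = dd v (dd u f) x y"
  using mixed_derivatives_commute[OF open_slit_bundle, of "\<lambda>(x, y). f x y" "(x, y)" v u] assms
  by (simp add: sm_def smooth_on_def mem_slit_bundle dd_def case_prod_unfold)

text \<open>\<open>pdx\<close> differentiates at frozen \<open>y\<close>; joint differentiability
  identifies it with a directional derivative on the product, where the symmetry of second
  derivatives is available.\<close>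

lemma pdx_eq_dd:
  assumes "sm f" "x \<in> U" "y \<noteq> 0"
  shows "pdx i f x y = dd (axis i 1, 0) f x y"
proof -
  have "((\<lambda>z. (z, y)) has_derivative (\<lambda>v. (v, 0))) (at x)"
    by (auto intro!: derivative_eq_intros)
  from diff_chain_at[OF this sm_has_derivative[OF assms]] show ?thesis
    by (simp add: pdx_def partial_def o_def flip: frechet_derivative_at)
qed

lemma pdy_eq_dd:
  assumes "sm f" "x \<in> U" "y \<noteq> 0"
  shows "pdy i f x y = dd (0, axis i 1) f x y"
proof -
  have "((\<lambda>z. (x, z)) has_derivative (\<lambda>v. (0, v))) (at y)"
    by (auto intro!: derivative_eq_intros)
  from diff_chain_at[OF this sm_has_derivative[OF assms]] show ?thesis
    by (simp add: pdy_def partial_def o_def flip: frechet_derivative_at)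
qed

lemma sm_pdx [intro]: "sm f \<Longrightarrow> sm (pdx i f)"
  using sm_cong[OF sm_dd] pdx_eq_dd by metis

lemma sm_pdy [intro]: "sm f \<Longrightarrow> sm (pdy i f)"
  using sm_cong[OF sm_dd] pdy_eq_dd by metis

lemma pd_commute:
  assumes "sm f" "x \<in> U" "y \<noteq> 0"
  shows "pdx i (pdx j f) x y = pdx j (pdx i f) x y"
    and "pdy i (pdy j f) x y = pdy j (pdy i f) x y"
    and "pdy i (pdx j f) x y = pdx j (pdy i f) x y"
proof -
  have x: "dd u (pdx i f) x y = dd u (dd (axis i 1, 0) f) x y" for u i
    by (rule dd_cong) (use assms in \<open>auto simp: pdx_eq_dd\<close>)
  have y: "dd u (pdy i f) x y = dd u (dd (0, axis i 1) f) x y" for u i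
    by (rule dd_cong) (use assms in \<open>auto simp: pdy_eq_dd\<close>)
  show "pdx i (pdx j f) x y = pdx j (pdx i f) x y"
    and "pdy i (pdy j f) x y = pdy j (pdy i f) x y"
    and "pdy i (pdx j f) x y = pdx j (pdy i f) x y"
    using assms by (simp_all add: pdx_eq_dd pdy_eq_dd sm_pdx sm_pdy x y dd_commute)
qed

text \<open>The congruence clause compares \<open>f\<close> and \<open>g\<close> on the slit bundle
  only, so equations valid there may be rewritten under a derivative whatever the functions do
  elsewhere. Smoothness of \<open>g\<close> follows from that of \<open>f\<close>.\<close>

definition derivation :: "real^'n \<Rightarrow> real^'n \<Rightarrow> ('n fibre_fun \<Rightarrow> real) \<Rightarrow> bool" where
  "derivation x y \<delta> \<longleftrightarrow> x \<in> U \<and> y \<noteq> 0 \<and>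
     (\<forall>f g. sm f \<longrightarrow> (\<forall>x\<in>U. \<forall>y. y \<noteq> 0 \<longrightarrow> f x y = g x y) \<longrightarrow> \<delta> f = \<delta> g) \<and>
     (\<forall>c. \<delta> (\<lambda>x y. c) = 0) \<and>
     (\<forall>f g. sm f \<longrightarrow> sm g \<longrightarrow> \<delta> (\<lambda>x y. f x y + g x y) = \<delta> f + \<delta> g) \<and>
     (\<forall>f g. sm f \<longrightarrow> sm g \<longrightarrow> \<delta> (\<lambda>x y. f x y * g x y) = \<delta> f * g x y + f x y * \<delta> g)"

lemma derivation_dd:
  assumes "x \<in> U" "y \<noteq> 0"
  shows "derivation x y (\<lambda>f. dd u f x y)"
  unfolding derivation_def
proof (intro conjI allI impI)
  show "dd u f x y = dd u g x y" if "sm f" "\<forall>x\<in>U. \<forall>y. y \<noteq> 0 \<longrightarrow> f x y = g x y" for f g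
    using dd_cong that assms by blast
  show "dd u (\<lambda>x y. c) x y = 0" for c
    by (simp add: dd_def case_prod_unfold)
next
  fix f g assume "sm f" "sm g"
  note D = sm_has_derivative[OF \<open>sm f\<close> assms] sm_has_derivative[OF \<open>sm g\<close> assms]
  show "dd u (\<lambda>x y. f x y + g x y) x y = dd u f x y + dd u g x y"
    using has_derivative_add[OF D]
    by (intro has_derivative_dd) (simp add: case_prod_unfold)
  show "dd u (\<lambda>x y. f x y * g x y) x y = dd u f x y * g x y + f x y * dd u g x y"
    using has_derivative_mult[OF D]
    by (subst has_derivative_dd) (simp_all add: case_prod_unfold add.commute)
qed (use assms in auto)

lemma derivation_cong:
  assumes "derivation x y \<delta>" "sm f" "\<And>x y. x \<in> U \<Longrightarrow> y \<noteq> 0 \<Longrightarrow> f x y = g x y"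
  shows "\<delta> f = \<delta> g"
proof -
  have "\<forall>f g. sm f \<longrightarrow> (\<forall>x\<in>U. \<forall>y. y \<noteq> 0 \<longrightarrow> f x y = g x y) \<longrightarrow> \<delta> f = \<delta> g"
    using assms(1) unfolding derivation_def by (elim conjE)
  then show ?thesis using assms(2,3) by simp
qed

lemma derivation_const: "derivation x y \<delta> \<Longrightarrow> \<delta> (\<lambda>x y. c) = 0"
  by (simp add: derivation_def)

lemma derivation_add:
  "derivation x y \<delta> \<Longrightarrow> sm f \<Longrightarrow> sm g \<Longrightarrow> \<delta> (\<lambda>x y. f x y + g x y) = \<delta> f + \<delta> g"
  by (simp add: derivation_def)

lemma derivation_mult:
  "derivation x y \<delta> \<Longrightarrow> sm f \<Longrightarrow> sm g \<Longrightarrow> \<delta> (\<lambda>x y. f x y * g x y) = \<delta> f * g x y + f x y * \<delta> g"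
  by (simp add: derivation_def)

lemma derivation_uminus:
  assumes "derivation x y \<delta>" "sm f"
  shows "\<delta> (\<lambda>x y. - f x y) = - \<delta> f"
  using derivation_mult[OF assms(1) sm_const[of "-1"] assms(2)] derivation_const[OF assms(1)]
  by simp

lemma derivation_diff:
  assumes "derivation x y \<delta>" "sm f" "sm g"
  shows "\<delta> (\<lambda>x y. f x y - g x y) = \<delta> f - \<delta> g"
  using derivation_add[OF assms(1,2) sm_uminus[OF assms(3)]] derivation_uminus[OF assms(1,3)]
  by simp

lemma derivation_sum:
  assumes "derivation x y \<delta>" "\<And>i. i \<in> I \<Longrightarrow> sm (f i)"
  shows "\<delta> (\<lambda>x y. \<Sum>i\<in>I. f i x y) = (\<Sum>i\<in>I. \<delta> (f i))"
  using assms(2)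
  by (induction I rule: infinite_finite_induct)
    (simp_all add: derivation_const[OF assms(1)] derivation_add[OF assms(1)] sm_sum)

text \<open>The coefficients \<open>c i\<close> are plain numbers: at a fixed point
  \<open>hor_deriv\<close> combines partial derivatives with the values of \<open>N\<close> at that
  point.\<close>

lemma derivation_combination:
  assumes "derivation x y \<delta>" "\<And>i. i \<in> I \<Longrightarrow> derivation x y (\<epsilon> i)"
  shows "derivation x y (\<lambda>f. \<delta> f + (\<Sum>i\<in>I. c i * \<epsilon> i f))"
proof -
  note \<delta> = assms(1)
  have ce: "\<epsilon> i f = \<epsilon> i g"
    if "i \<in> I" "sm f" "\<forall>x\<in>U. \<forall>y. y \<noteq> 0 \<longrightarrow> f x y = g x y" for i f g
    using derivation_cong[OF assms(2)] that by blast
  show ?thesis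
    unfolding derivation_def
  proof (intro conjI allI impI)
    show "x \<in> U" "y \<noteq> 0" using \<delta> by (auto simp: derivation_def)
    show "\<delta> f + (\<Sum>i\<in>I. c i * \<epsilon> i f) = \<delta> g + (\<Sum>i\<in>I. c i * \<epsilon> i g)"
      if "sm f" "\<forall>x\<in>U. \<forall>y. y \<noteq> 0 \<longrightarrow> f x y = g x y" for f g
      using derivation_cong[OF \<delta> that(1)] that(2) ce[OF _ that] by (metis (no_types, lifting) sum.cong)
  next
    fix f g assume "sm f" "sm g"
    then show "\<delta> (\<lambda>x y. f x y * g x y) + (\<Sum>i\<in>I. c i * \<epsilon> i (\<lambda>x y. f x y * g x y)) =
        (\<delta> f + (\<Sum>i\<in>I. c i * \<epsilon> i f)) * g x y + f x y * (\<delta> g + (\<Sum>i\<in>I. c i * \<epsilon> i g))"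
      by (simp add: derivation_mult[OF \<delta>] derivation_mult[OF assms(2)] sum.distrib
          sum_distrib_left sum_distrib_right algebra_simps cong: sum.cong)
  qed (simp_all add: derivation_const[OF \<delta>] derivation_const[OF assms(2)] derivation_add[OF \<delta>]
      derivation_add[OF assms(2)] sum.distrib algebra_simps cong: sum.cong)
qed

lemma derivation_transfer:
  assumes \<delta>: "derivation x y \<delta>" and e: "\<And>f. sm f \<Longrightarrow> \<epsilon> f = \<delta> f"
  shows "derivation x y \<epsilon>"
  unfolding derivation_def
proof (intro conjI allI impI)
  show "x \<in> U" "y \<noteq> 0" using \<delta> by (auto simp: derivation_def)
  show "\<epsilon> f = \<epsilon> g" if f: "sm f" and fg: "\<forall>x\<in>U. \<forall>y. y \<noteq> 0 \<longrightarrow> f x y = g x y" for f g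
  proof -
    have "sm g" by (rule sm_cong[OF f]) (use fg in simp)
    moreover have "\<delta> f = \<delta> g" by (rule derivation_cong[OF \<delta> f]) (use fg in simp)
    ultimately show ?thesis using e f by simp
  qed
qed (simp_all add: e sm_const sm_add sm_mult derivation_const[OF \<delta>] derivation_add[OF \<delta>]
    derivation_mult[OF \<delta>])

lemma derivation_pdx:
  assumes "x \<in> U" "y \<noteq> 0"
  shows "derivation x y (\<lambda>f. pdx i f x y)"
  using derivation_dd[OF assms] by (rule derivation_transfer) (use assms pdx_eq_dd in simp)

lemma derivation_pdy:
  assumes "x \<in> U" "y \<noteq> 0"
  shows "derivation x y (\<lambda>f. pdy i f x y)"
  using derivation_dd[OF assms] by (rule derivation_transfer) (use assms pdy_eq_dd in simp)

lemma derivation_hor: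
  assumes "x \<in> U" "y \<noteq> 0"
  shows "derivation x y (\<lambda>f. hor_deriv N i f x y)"
  unfolding hor_deriv_def
  by (intro derivation_combination derivation_pdx derivation_pdy assms)

section \<open>Horizontal derivatives and their commutators\<close>

lemma sm_hor [intro]:
  assumes "\<And>k. sm (N k i)" "sm f"
  shows "sm (hor_deriv N i f)"
  unfolding hor_deriv_def using assms by (auto intro!: sm_add sm_sum sm_mult sm_pdx sm_pdy)

text \<open>Partial derivatives commute, so the commutator with \<open>hor_deriv\<close> comes from
  differentiating the coefficients \<open>N\<close> alone.\<close>

lemma pdy_hor:
  assumes "\<And>k. sm (N k i)" "sm f" "x \<in> U" "y \<noteq> 0"
  shows "pdy k (hor_deriv N i f) x y
    = hor_deriv N i (pdy k f) x y + (\<Sum>m\<in>UNIV. pdy k (N m i) x y * pdy m f x y)"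
proof -
  note D = derivation_pdy[OF assms(3,4), of k]
  have "pdy k (hor_deriv N i f) x y
      = pdy k (pdx i f) x y + (\<Sum>m\<in>UNIV. pdy k (\<lambda>x y. N m i x y * pdy m f x y) x y)"
    using assms(1,2) by (simp add: hor_deriv_def[abs_def] derivation_add[OF D] derivation_sum[OF D]
        sm_pdx sm_pdy sm_mult sm_sum)
  then show ?thesis
    using assms by (simp add: derivation_mult[OF D] sm_pdy hor_deriv_def sum.distrib
        pd_commute(3) pd_commute(2)[of f x y k])
qed

lemma pdx_hor:
  assumes "\<And>k. sm (N k i)" "sm f" "x \<in> U" "y \<noteq> 0"
  shows "pdx k (hor_deriv N i f) x y
    = hor_deriv N i (pdx k f) x y + (\<Sum>m\<in>UNIV. pdx k (N m i) x y * pdy m f x y)"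
proof -
  note D = derivation_pdx[OF assms(3,4), of k]
  have "pdx k (hor_deriv N i f) x y
      = pdx k (pdx i f) x y + (\<Sum>m\<in>UNIV. pdx k (\<lambda>x y. N m i x y * pdy m f x y) x y)"
    using assms(1,2) by (simp add: hor_deriv_def[abs_def] derivation_add[OF D] derivation_sum[OF D]
        sm_pdx sm_pdy sm_mult sm_sum)
  then show ?thesis
    using assms by (simp add: derivation_mult[OF D] sm_pdy hor_deriv_def sum.distrib
        pd_commute(3) pd_commute(1)[of f x y k])
qed

text \<open>The two iterated derivatives are expanded asymmetrically: in one the inner operator is
  split into partial derivatives, in the other the outer one. The second derivatives of
  \<open>f\<close> then appear in both as \<open>hor_deriv N i\<close> of a partial derivative and
  cancel directly.\<close>

lemma hor_commutator:
  assumes N: "\<And>k i. sm (N k i)" and "sm f" "x \<in> U" "y \<noteq> 0"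
  shows "hor_deriv N i (hor_deriv N j f) x y - hor_deriv N j (hor_deriv N i f) x y
    = (\<Sum>n\<in>UNIV. M_curv N n i j x y * pdy n f x y)"
proof -
  note D = derivation_hor[OF assms(3,4), of N i]
  have 1: "hor_deriv N i (hor_deriv N j f) x y = hor_deriv N i (pdx j f) x y
      + (\<Sum>n\<in>UNIV. hor_deriv N i (N n j) x y * pdy n f x y + N n j x y * hor_deriv N i (pdy n f) x y)"
  proof -
    have "hor_deriv N i (hor_deriv N j f) x y
      = hor_deriv N i (\<lambda>x y. pdx j f x y + (\<Sum>n\<in>UNIV. N n j x y * pdy n f x y)) x y"
      by (simp add: hor_deriv_def[of N j f, abs_def])
    then show ?thesis
      using assms by (simp add: derivation_add[OF D] derivation_sum[OF D] derivation_mult[OF D]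
          sm_pdx sm_pdy sm_mult sm_sum)
  qed
  have 2: "hor_deriv N j (hor_deriv N i f) x y
    = hor_deriv N i (pdx j f) x y + (\<Sum>m\<in>UNIV. pdx j (N m i) x y * pdy m f x y)
      + (\<Sum>n\<in>UNIV. N n j x y * (hor_deriv N i (pdy n f) x y
          + (\<Sum>m\<in>UNIV. pdy n (N m i) x y * pdy m f x y)))"
    using assms by (subst hor_deriv_def) (simp add: pdx_hor pdy_hor)
  have 3: "(\<Sum>n\<in>UNIV. N n j x y * (\<Sum>m\<in>UNIV. pdy n (N m i) x y * pdy m f x y))
    = (\<Sum>m\<in>UNIV. (\<Sum>n\<in>UNIV. N n j x y * pdy n (N m i) x y) * pdy m f x y)"
    unfolding sum_distrib_left sum_distrib_right
    by (subst sum.swap) (simp add: mult.assoc)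
  have 4: "hor_deriv N j (N m i) x y * c
      = pdx j (N m i) x y * c + (\<Sum>n\<in>UNIV. N n j x y * pdy n (N m i) x y) * c" for m c
    by (simp add: hor_deriv_def distrib_right)
  show ?thesis
    unfolding 1 2 M_curv_def
    by (simp add: sum.distrib sum_subtractf distrib_left left_diff_distrib 3 4)
qed

text \<open>Moving \<open>pdy k\<close> past \<open>hor_deriv\<close> produces products of two fibre
  derivatives of \<open>N\<close>, and these are exactly the quadratic terms of
  \<open>E_curv\<close>.\<close>

lemma E_curv_eq_pdy_M_curv:
  assumes N: "\<And>k i. sm (N k i)" and "x \<in> U" "y \<noteq> 0"
  shows "E_curv N k n i j x y = - pdy k (M_curv N n i j) x y"
proof -
  note D = derivation_pdy[OF assms(2,3), of k] and H = derivation_hor[OF assms(2,3), of N]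
  have c: "hor_deriv N i (conn_coeff N n j k) x y = - hor_deriv N i (pdy k (N n j)) x y" for i j
    unfolding conn_coeff_def[abs_def] by (intro derivation_uminus[OF H] sm_pdy N)
  have "pdy k (M_curv N n i j) x y
      = pdy k (hor_deriv N i (N n j)) x y - pdy k (hor_deriv N j (N n i)) x y"
    unfolding M_curv_def[abs_def] by (intro derivation_diff[OF D] sm_hor N)
  then show ?thesis
    using assms by (simp add: pdy_hor E_curv_def c) (simp add: conn_coeff_def)
qed

end

subsection \<open>Matrix algebra\<close>

lemma matrix_add_rdistrib': "(A + B) ** C = A ** C + B ** (C :: real^'k^'n)"
  by (simp add: vec_eq_iff matrix_matrix_mult_def sum.distrib distrib_right)

lemma matrix_diff_ldistrib: "A ** (B - C) = A ** B - A ** (C :: real^'k^'n)"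
  by (simp add: vec_eq_iff matrix_matrix_mult_def sum_subtractf right_diff_distrib)

lemma matrix_diff_rdistrib: "(A - B) ** C = A ** C - B ** (C :: real^'k^'n)"
  by (simp add: vec_eq_iff matrix_matrix_mult_def sum_subtractf left_diff_distrib)

lemma matrix_uminus_left: "(- A) ** C = - (A ** (C :: real^'k^'n))"
  by (simp add: vec_eq_iff matrix_matrix_mult_def sum_negf)

lemma matrix_uminus_right: "A ** (- C) = - (A ** (C :: real^'k^'n))"
  by (simp add: vec_eq_iff matrix_matrix_mult_def sum_negf)

lemma matrix_vector_uminus_left: "(- A) *v v = - (A *v (v :: real^'n))"
  by (simp add: vec_eq_iff matrix_vector_mult_def sum_negf)

lemma matrix_vector_uminus_right: "A *v (- v) = - (A *v (v :: real^'n))"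
  by (simp add: vec_eq_iff matrix_vector_mult_def sum_negf)

lemma matrix_scaleR_left: "(c *\<^sub>R A) ** C = c *\<^sub>R (A ** (C :: real^'k^'n))"
  by (rule scalar_matrix_assoc[symmetric])

lemma matrix_scaleR_right: "A ** (c *\<^sub>R C) = c *\<^sub>R (A ** (C :: real^'k^'n))"
  by (simp add: matrix_scalar_ac matrix_scaleR_left)

lemmas matrix_ring_simps = matrix_add_ldistrib matrix_add_rdistrib' matrix_diff_ldistrib
  matrix_diff_rdistrib matrix_uminus_left matrix_uminus_right matrix_scaleR_left
  matrix_scaleR_right matrix_mul_assoc

lemma transpose_add: "transpose (A + B) = transpose A + transpose (B :: real^'k^'n)"
  by (simp add: vec_eq_iff transpose_def)

lemma transpose_diff: "transpose (A - B) = transpose A - transpose (B :: real^'k^'n)"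
  by (simp add: vec_eq_iff transpose_def)

lemma transpose_uminus: "transpose (- A) = - transpose (A :: real^'k^'n)"
  by (simp add: vec_eq_iff transpose_def)

lemma inner_transpose: "x \<bullet> (transpose A *v y) = ((A :: real^'n^'m) *v x) \<bullet> y"
  using dot_lmul_matrix[of y A x] by (simp add: inner_commute)

definition outer :: "real^'n \<Rightarrow> real^'k \<Rightarrow> real^'k^'n" where
  "outer u w = (\<chi> r c. u $ r * w $ c)"

lemma matrix_mult_outer: "A ** outer u w = outer (A *v u) w"
  by (simp add: vec_eq_iff matrix_matrix_mult_def matrix_vector_mult_def outer_def
      sum_distrib_right mult.assoc)

lemma outer_mult_matrix: "outer u w ** A = outer u (transpose A *v w)"
  by (simp add: vec_eq_iff matrix_matrix_mult_def matrix_vector_mult_def outer_def transpose_def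
      sum_distrib_left algebra_simps del: transpose_matrix_vector)

lemma outer_mult_vector: "outer u w *v v = (w \<bullet> v) *\<^sub>R u"
  by (simp add: vec_eq_iff matrix_vector_mult_def outer_def inner_vec_def
      sum_distrib_left sum_distrib_right algebra_simps)

lemma transpose_outer: "transpose (outer u w) = outer w u"
  by (simp add: vec_eq_iff transpose_def outer_def mult.commute)

lemma trace_outer: "trace (outer u w) = u \<bullet> w"
  by (simp add: trace_def outer_def inner_vec_def)

lemma matrix_inv_works:
  assumes "invertible (A :: real^'n^'n)"
  shows "A ** matrix_inv A = mat 1" "matrix_inv A ** A = mat 1"
  using someI_ex[of "\<lambda>A'. A ** A' = mat 1 \<and> A' ** A = mat 1"] assms
  by (simp_all add: invertible_def matrix_inv_def)

lemma matrix_inv_unique: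
  assumes "A ** B = mat 1"
  shows "matrix_inv A = (B :: real^'n^'n)"
  using assms matrix_inv_works(2)[of A] invertible_right_inverse matrix_mul_assoc[of "matrix_inv A" A B]
  by (metis matrix_mul_lid matrix_mul_rid)

lemma pos_def_invertible:
  assumes "pos_def A"
  shows "invertible A"
proof -
  have "v = 0" if "A *v v = 0" for v
    using assms that unfolding pos_def_def by (metis inner_zero_right less_irrefl)
  then show ?thesis
    unfolding invertible_left_inverse matrix_left_invertible_ker by blast
qed

text \<open>Cramer's rule for the \<open>j\<close>-th column of the inverse. It presents the entries
  as quotients of polynomials in the entries of \<open>A\<close>, which is how smoothness passes to
  inverse matrices.\<close>

lemma matrix_inv_component:
  assumes "invertible (A :: real^'n^'n)"
  shows "matrix_inv A $ k $ j
    = det (\<chi> r c. if c = k then if r = j then 1 else 0 else A $ r $ c) / det A"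
proof -
  have "A *v (matrix_inv A *v axis j 1) = axis j 1"
    using matrix_inv_works[OF assms] by (simp add: matrix_vector_mul_assoc)
  then have "matrix_inv A *v axis j 1
      = (\<chi> k. det (\<chi> r c. if c = k then axis j 1 $ r else A $ r $ c) / det A)"
    using cramer[of A "matrix_inv A *v axis j 1" "axis j 1"] assms by (simp add: invertible_det_nz)
  then have "(matrix_inv A *v axis j 1) $ k
      = det (\<chi> r c. if c = k then axis j 1 $ r else A $ r $ c) / det A" by simp
  moreover have "(matrix_inv A *v axis j 1) $ k = matrix_inv A $ k $ j"
    by (simp add: matrix_vector_mult_basis column_def)
  moreover have "axis j 1 $ r = (if r = j then 1 else 0 :: real)" for r
    by (simp add: axis_def)
  ultimately show ?thesis by (simp cong: if_cong)
qed


subsection \<open>Index contractions as traces\<close>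

lemma sum_swap_triple:
  "(\<Sum>k\<in>A. \<Sum>i\<in>B. \<Sum>j\<in>C. f k i j) = (\<Sum>i\<in>B. \<Sum>j\<in>C. \<Sum>k\<in>A. f k i j)"
  by (subst sum.swap, rule sum.cong[OF refl], rule sum.swap)

lemma sum_swap_pairs:
  "(\<Sum>k\<in>A. \<Sum>n\<in>B. \<Sum>i\<in>C. \<Sum>j\<in>D. f k n i j) = (\<Sum>i\<in>C. \<Sum>j\<in>D. \<Sum>k\<in>A. \<Sum>n\<in>B. f k n i j)"
proof -
  have "(\<Sum>k\<in>A. \<Sum>n\<in>B. \<Sum>i\<in>C. \<Sum>j\<in>D. f k n i j) = (\<Sum>k\<in>A. \<Sum>i\<in>C. \<Sum>n\<in>B. \<Sum>j\<in>D. f k n i j)"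
    by (rule sum.cong[OF refl], rule sum.swap)
  also have "\<dots> = (\<Sum>i\<in>C. \<Sum>k\<in>A. \<Sum>j\<in>D. \<Sum>n\<in>B. f k n i j)"
    by (subst sum.swap, rule sum.cong[OF refl], rule sum.cong[OF refl], rule sum.swap)
  also have "\<dots> = (\<Sum>i\<in>C. \<Sum>j\<in>D. \<Sum>k\<in>A. \<Sum>n\<in>B. f k n i j)"
    by (rule sum.cong[OF refl], rule sum.swap)
  finally show ?thesis .
qed

lemma trace_mult_transpose:
  "trace (X ** transpose Y) = (\<Sum>k\<in>UNIV. \<Sum>n\<in>UNIV. X $ k $ n * (Y :: real^'n^'n) $ k $ n)"
  by (simp add: trace_def matrix_matrix_mult_def transpose_def)

lemma congruence_component:
  "(S ** X ** transpose S) $ k $ n = (\<Sum>p\<in>UNIV. \<Sum>q\<in>UNIV. S $ k $ p * S $ n $ q * (X :: real^'n^'n) $ p $ q)"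
  unfolding matrix_matrix_mult_def transpose_def
  by (subst sum.swap) (simp add: sum_distrib_left sum_distrib_right mult_ac)

text \<open>\<open>S\<close> raises the first two indices and \<open>T\<close> the last two, as in
  \<open>rho_raise\<close>; \<open>S = T\<close> covers the Riemannian tensor. The last two indices
  stay outside as labels of the matrices \<open>L i j\<close>.\<close>

lemma contraction_eq_trace:
  fixes S T :: "real^'n^'n" and L :: "'n \<Rightarrow> 'n \<Rightarrow> real^'n^'n"
  shows "(\<Sum>k\<in>UNIV. \<Sum>n\<in>UNIV. \<Sum>i\<in>UNIV. \<Sum>j\<in>UNIV.
      (\<Sum>p\<in>UNIV. \<Sum>q\<in>UNIV. \<Sum>r\<in>UNIV. \<Sum>s\<in>UNIV.
        S $ k $ p * S $ n $ q * T $ i $ r * T $ j $ s * L r s $ p $ q) * L i j $ k $ n)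
    = (\<Sum>i\<in>UNIV. \<Sum>j\<in>UNIV. \<Sum>r\<in>UNIV. \<Sum>s\<in>UNIV.
        T $ i $ r * T $ j $ s * trace (S ** L r s ** transpose S ** transpose (L i j)))"
proof -
  have 1: "(\<Sum>p\<in>UNIV. \<Sum>q\<in>UNIV. \<Sum>r\<in>UNIV. \<Sum>s\<in>UNIV.
        S $ k $ p * S $ n $ q * T $ i $ r * T $ j $ s * L r s $ p $ q)
    = (\<Sum>r\<in>UNIV. \<Sum>s\<in>UNIV. T $ i $ r * T $ j $ s * (S ** L r s ** transpose S) $ k $ n)" for k n i j
    unfolding congruence_component sum_distrib_left
    by (subst sum_swap_pairs) (simp add: mult_ac)
  have "(\<Sum>k\<in>UNIV. \<Sum>n\<in>UNIV. \<Sum>i\<in>UNIV. \<Sum>j\<in>UNIV.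
      (\<Sum>r\<in>UNIV. \<Sum>s\<in>UNIV. T $ i $ r * T $ j $ s * (S ** L r s ** transpose S) $ k $ n) * L i j $ k $ n)
    = (\<Sum>i\<in>UNIV. \<Sum>j\<in>UNIV. \<Sum>k\<in>UNIV. \<Sum>n\<in>UNIV. \<Sum>r\<in>UNIV. \<Sum>s\<in>UNIV.
      T $ i $ r * T $ j $ s * ((S ** L r s ** transpose S) $ k $ n * L i j $ k $ n))"
    by (subst sum_swap_pairs) (simp add: sum_distrib_right mult.assoc)
  also have "\<dots> = (\<Sum>i\<in>UNIV. \<Sum>j\<in>UNIV. \<Sum>r\<in>UNIV. \<Sum>s\<in>UNIV. \<Sum>k\<in>UNIV. \<Sum>n\<in>UNIV.
      T $ i $ r * T $ j $ s * ((S ** L r s ** transpose S) $ k $ n * L i j $ k $ n))"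
    by (rule sum.cong[OF refl], rule sum.cong[OF refl], rule sum_swap_pairs)
  finally show ?thesis
    unfolding 1 trace_mult_transpose by (simp only: sum_distrib_left)
qed

text \<open>The analogue in which the first index of each factor is contracted with a vector, for
  the term of the quadratic invariant that contains \<open>t\<close>.\<close>

lemma vector_contraction_eq:
  fixes T :: "real^'n^'n" and L :: "'n \<Rightarrow> 'n \<Rightarrow> real^'n^'n" and v :: "real^'n"
  shows "(\<Sum>l\<in>UNIV. \<Sum>h\<in>UNIV. \<Sum>n\<in>UNIV. \<Sum>i\<in>UNIV. \<Sum>j\<in>UNIV.
      v $ l * (\<Sum>q\<in>UNIV. \<Sum>r\<in>UNIV. \<Sum>s\<in>UNIV. T $ n $ q * T $ i $ r * T $ j $ s * L r s $ l $ q)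
        * v $ h * L i j $ h $ n)
    = (\<Sum>i\<in>UNIV. \<Sum>j\<in>UNIV. \<Sum>r\<in>UNIV. \<Sum>s\<in>UNIV.
        T $ i $ r * T $ j $ s * (v \<bullet> ((L r s ** transpose T ** transpose (L i j)) *v v)))"
proof -
  define Z where "Z i j n = (\<Sum>h\<in>UNIV. v $ h * L i j $ h $ n)" for i j n
  define Y where "Y r s n = (\<Sum>l\<in>UNIV. v $ l * (L r s ** transpose T) $ l $ n)" for r s n
  have 1: "(\<Sum>q\<in>UNIV. \<Sum>r\<in>UNIV. \<Sum>s\<in>UNIV. T $ n $ q * T $ i $ r * T $ j $ s * L r s $ l $ q)
    = (\<Sum>r\<in>UNIV. \<Sum>s\<in>UNIV. T $ i $ r * T $ j $ s * (L r s ** transpose T) $ l $ n)" for n i j l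
  proof -
    have "(\<Sum>q\<in>UNIV. \<Sum>r\<in>UNIV. \<Sum>s\<in>UNIV. T $ n $ q * T $ i $ r * T $ j $ s * L r s $ l $ q)
      = (\<Sum>r\<in>UNIV. \<Sum>s\<in>UNIV. \<Sum>q\<in>UNIV. T $ n $ q * T $ i $ r * T $ j $ s * L r s $ l $ q)"
      by (rule sum_swap_triple)
    then show ?thesis
      by (simp add: matrix_matrix_mult_def transpose_def sum_distrib_left mult_ac)
  qed
  have 2: "v \<bullet> ((L r s ** transpose T ** transpose (L i j)) *v v) = (\<Sum>n\<in>UNIV. Y r s n * Z i j n)"
    for r s i j
  proof -
    have z: "transpose (L i j) *v v = (\<chi> n. Z i j n)"
      by (simp add: vec_eq_iff Z_def matrix_vector_mult_def transpose_def mult.commute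
          del: transpose_matrix_vector)
    have "v \<bullet> (X *v (\<chi> n. Z i j n)) = (\<Sum>l\<in>UNIV. v $ l * (\<Sum>n\<in>UNIV. X $ l $ n * Z i j n))"
      for X :: "real^'n^'n"
      by (simp add: inner_vec_def matrix_vector_mult_def)
    then have "v \<bullet> ((L r s ** transpose T ** transpose (L i j)) *v v)
      = (\<Sum>l\<in>UNIV. v $ l * (\<Sum>n\<in>UNIV. (L r s ** transpose T) $ l $ n * Z i j n))"
      unfolding matrix_vector_mul_assoc[of "L r s ** transpose T", symmetric] z .
    also have "\<dots> = (\<Sum>n\<in>UNIV. Y r s n * Z i j n)"
      unfolding Y_def sum_distrib_left sum_distrib_right by (subst sum.swap) (simp add: mult_ac)
    finally show ?thesis .
  qed
  have "(\<Sum>l\<in>UNIV. \<Sum>h\<in>UNIV. \<Sum>n\<in>UNIV. \<Sum>i\<in>UNIV. \<Sum>j\<in>UNIV.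
      v $ l * (\<Sum>r\<in>UNIV. \<Sum>s\<in>UNIV. T $ i $ r * T $ j $ s * (L r s ** transpose T) $ l $ n)
        * v $ h * L i j $ h $ n)
    = (\<Sum>n\<in>UNIV. \<Sum>i\<in>UNIV. \<Sum>j\<in>UNIV. \<Sum>l\<in>UNIV. \<Sum>h\<in>UNIV.
      v $ l * (\<Sum>r\<in>UNIV. \<Sum>s\<in>UNIV. T $ i $ r * T $ j $ s * (L r s ** transpose T) $ l $ n)
        * v $ h * L i j $ h $ n)"
    by (rule trans[OF sum_swap_triple[symmetric]], rule sum.cong[OF refl], rule sum_swap_pairs)
  also have "\<dots> = (\<Sum>n\<in>UNIV. \<Sum>i\<in>UNIV. \<Sum>j\<in>UNIV.
      (\<Sum>l\<in>UNIV. v $ l * (\<Sum>r\<in>UNIV. \<Sum>s\<in>UNIV. T $ i $ r * T $ j $ s * (L r s ** transpose T) $ l $ n))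
        * Z i j n)"
    by (simp add: Z_def sum_product mult.assoc)
  also have "\<dots> = (\<Sum>n\<in>UNIV. \<Sum>i\<in>UNIV. \<Sum>j\<in>UNIV.
      (\<Sum>r\<in>UNIV. \<Sum>s\<in>UNIV. T $ i $ r * T $ j $ s * (Y r s n * Z i j n)))"
  proof -
    have "(\<Sum>l\<in>UNIV. v $ l * (\<Sum>r\<in>UNIV. \<Sum>s\<in>UNIV. T $ i $ r * T $ j $ s * (L r s ** transpose T) $ l $ n))
      = (\<Sum>r\<in>UNIV. \<Sum>s\<in>UNIV. T $ i $ r * T $ j $ s * Y r s n)" for i j n
    proof -
      have "(\<Sum>l\<in>UNIV. v $ l * (\<Sum>r\<in>UNIV. \<Sum>s\<in>UNIV. T $ i $ r * T $ j $ s * (L r s ** transpose T) $ l $ n))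
        = (\<Sum>l\<in>UNIV. \<Sum>r\<in>UNIV. \<Sum>s\<in>UNIV. T $ i $ r * T $ j $ s * (v $ l * (L r s ** transpose T) $ l $ n))"
        by (simp add: sum_distrib_left mult_ac)
      also have "\<dots> = (\<Sum>r\<in>UNIV. \<Sum>s\<in>UNIV. \<Sum>l\<in>UNIV.
          T $ i $ r * T $ j $ s * (v $ l * (L r s ** transpose T) $ l $ n))"
        by (rule sum_swap_triple)
      finally show ?thesis by (simp add: Y_def sum_distrib_left)
    qed
    then show ?thesis by (simp add: sum_distrib_right mult.assoc)
  qed
  also have "\<dots> = (\<Sum>i\<in>UNIV. \<Sum>j\<in>UNIV. \<Sum>n\<in>UNIV. \<Sum>r\<in>UNIV. \<Sum>s\<in>UNIV.
      T $ i $ r * T $ j $ s * (Y r s n * Z i j n))"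
    by (rule sum_swap_triple)
  also have "\<dots> = (\<Sum>i\<in>UNIV. \<Sum>j\<in>UNIV. \<Sum>r\<in>UNIV. \<Sum>s\<in>UNIV. \<Sum>n\<in>UNIV.
      T $ i $ r * T $ j $ s * (Y r s n * Z i j n))"
    by (rule sum.cong[OF refl], rule sum.cong[OF refl], rule sum_swap_triple)
  finally show ?thesis
    unfolding 1 2 by (simp only: sum_distrib_left)
qed


subsection \<open>Matrix-valued functions on the slit tangent bundle\<close>

context slit_calculus
begin

definition msm :: "(real^'n \<Rightarrow> real^'n \<Rightarrow> real^'n^'n) \<Rightarrow> bool" where
  "msm X \<longleftrightarrow> (\<forall>r c. sm (\<lambda>x y. X x y $ r $ c))"

definition vsm :: "(real^'n \<Rightarrow> real^'n \<Rightarrow> real^'n) \<Rightarrow> bool" where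
  "vsm v \<longleftrightarrow> (\<forall>r. sm (\<lambda>x y. v x y $ r))"

definition mder :: "('n fibre_fun \<Rightarrow> 'n fibre_fun) \<Rightarrow> (real^'n \<Rightarrow> real^'n \<Rightarrow> real^'n^'n) \<Rightarrow>
    real^'n \<Rightarrow> real^'n \<Rightarrow> real^'n^'n" where
  "mder \<delta> X x y = (\<chi> r c. \<delta> (\<lambda>x y. X x y $ r $ c) x y)"

definition vder :: "('n fibre_fun \<Rightarrow> 'n fibre_fun) \<Rightarrow> (real^'n \<Rightarrow> real^'n \<Rightarrow> real^'n) \<Rightarrow>
    real^'n \<Rightarrow> real^'n \<Rightarrow> real^'n" where
  "vder \<delta> v x y = (\<chi> r. \<delta> (\<lambda>x y. v x y $ r) x y)"

lemma msm_component: "msm X \<Longrightarrow> sm (\<lambda>x y. X x y $ r $ c)"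
  by (simp add: msm_def)

lemma vsm_component: "vsm v \<Longrightarrow> sm (\<lambda>x y. v x y $ r)"
  by (simp add: vsm_def)

lemma msm_add [intro]: "msm X \<Longrightarrow> msm Y \<Longrightarrow> msm (\<lambda>x y. X x y + Y x y)"
  by (auto simp: msm_def)

lemma msm_diff [intro]: "msm X \<Longrightarrow> msm Y \<Longrightarrow> msm (\<lambda>x y. X x y - Y x y)"
  by (auto simp: msm_def)

lemma msm_mult [intro]: "msm X \<Longrightarrow> msm Y \<Longrightarrow> msm (\<lambda>x y. X x y ** Y x y)"
  by (auto simp: msm_def matrix_matrix_mult_def intro!: sm_sum sm_mult)

lemma msm_transpose [intro]: "msm X \<Longrightarrow> msm (\<lambda>x y. transpose (X x y))"
  by (auto simp: msm_def transpose_def)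

lemma msm_scaleR [intro]: "sm f \<Longrightarrow> msm X \<Longrightarrow> msm (\<lambda>x y. f x y *\<^sub>R X x y)"
  by (auto simp: msm_def)

lemma msm_outer [intro]: "vsm u \<Longrightarrow> vsm w \<Longrightarrow> msm (\<lambda>x y. outer (u x y) (w x y))"
  by (auto simp: msm_def vsm_def outer_def)

lemma vsm_mult [intro]: "msm X \<Longrightarrow> vsm v \<Longrightarrow> vsm (\<lambda>x y. X x y *v v x y)"
  by (auto simp: msm_def vsm_def matrix_vector_mult_def intro!: sm_sum sm_mult)

lemma vsm_uminus [intro]: "vsm v \<Longrightarrow> vsm (\<lambda>x y. - v x y)"
  by (auto simp: vsm_def)

lemma vsm_add [intro]: "vsm v \<Longrightarrow> vsm w \<Longrightarrow> vsm (\<lambda>x y. v x y + w x y)"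
  by (auto simp: vsm_def)

lemma sm_inner [intro]: "vsm v \<Longrightarrow> vsm w \<Longrightarrow> sm (\<lambda>x y. v x y \<bullet> w x y)"
  by (auto simp: vsm_def inner_vec_def intro!: sm_sum sm_mult)

lemma sm_det: "msm X \<Longrightarrow> sm (\<lambda>x y. det (X x y))"
  by (auto simp: msm_def det_def intro!: sm_sum sm_mult sm_prod)

lemma msm_cong:
  assumes "msm X" "\<And>x y. x \<in> U \<Longrightarrow> y \<noteq> 0 \<Longrightarrow> X x y = Y x y"
  shows "msm Y"
  unfolding msm_def
proof (intro allI)
  fix r c
  show "sm (\<lambda>x y. Y x y $ r $ c)"
    by (rule sm_cong[OF msm_component[OF assms(1)]]) (simp add: assms(2))
qed

lemma msm_matrix_inv:
  assumes "msm X" "\<And>x y. x \<in> U \<Longrightarrow> y \<noteq> 0 \<Longrightarrow> invertible (X x y)"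
  shows "msm (\<lambda>x y. matrix_inv (X x y))"
  unfolding msm_def
proof (intro allI)
  fix k j
  have "sm (\<lambda>x y. det (\<chi> r c. if c = k then if r = j then 1 else 0 else X x y $ r $ c)
      / det (X x y))"
  proof (intro sm_divide sm_det assms(1))
    show "msm (\<lambda>x y. \<chi> r c. if c = k then if r = j then 1 else 0 else X x y $ r $ c)"
      unfolding msm_def
    proof (intro allI)
      fix r' c'
      show "sm (\<lambda>x y. (\<chi> r c. if c = k then if r = j then 1 else 0 else X x y $ r $ c) $ r' $ c')"
        by (cases "c' = k"; cases "r' = j"; simp add: sm_const msm_component[OF assms(1)])
    qed
  qed (use assms(2) invertible_det_nz in blast)
  then show "sm (\<lambda>x y. matrix_inv (X x y) $ k $ j)"
    by (rule sm_cong) (simp add: matrix_inv_component assms(2))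
qed

text \<open>Preservation of smoothness is included so that such operators can be iterated, as the
  commutator arguments require.\<close>

definition smooth_derivation :: "('n fibre_fun \<Rightarrow> 'n fibre_fun) \<Rightarrow> bool" where
  "smooth_derivation \<delta> \<longleftrightarrow> (\<forall>x\<in>U. \<forall>y. y \<noteq> 0 \<longrightarrow> derivation x y (\<lambda>f. \<delta> f x y)) \<and>
     (\<forall>f. sm f \<longrightarrow> sm (\<delta> f))"

lemma smooth_derivation_pdx: "smooth_derivation (pdx i)"
  by (simp add: smooth_derivation_def derivation_pdx sm_pdx)

lemma smooth_derivation_pdy: "smooth_derivation (pdy i)"
  by (simp add: smooth_derivation_def derivation_pdy sm_pdy)

lemma smooth_derivation_hor: "(\<And>k. sm (N k i)) \<Longrightarrow> smooth_derivation (hor_deriv N i)"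
  by (simp add: smooth_derivation_def derivation_hor sm_hor)

context
  fixes \<delta> :: "'n fibre_fun \<Rightarrow> 'n fibre_fun"
  assumes \<delta>: "smooth_derivation \<delta>"
begin

lemma msm_mder: "msm X \<Longrightarrow> msm (mder \<delta> X)"
  using \<delta> by (auto simp: msm_def mder_def smooth_derivation_def)

lemma vsm_vder: "vsm v \<Longrightarrow> vsm (vder \<delta> v)"
  using \<delta> by (auto simp: vsm_def vder_def smooth_derivation_def)

context
  fixes x y :: "real^'n"
  assumes x: "x \<in> U" and y: "y \<noteq> 0"
begin

lemma smooth_derivation_at: "derivation x y (\<lambda>f. \<delta> f x y)"
  using \<delta> x y by (simp add: smooth_derivation_def)

lemma mder_cong:
  assumes "msm X" "\<And>x y. x \<in> U \<Longrightarrow> y \<noteq> 0 \<Longrightarrow> X x y = Y x y"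
  shows "mder \<delta> X x y = mder \<delta> Y x y"
  unfolding mder_def
proof (intro arg_cong[where f = vec_lambda] ext)
  fix r c
  show "\<delta> (\<lambda>x y. X x y $ r $ c) x y = \<delta> (\<lambda>x y. Y x y $ r $ c) x y"
    by (rule derivation_cong[OF smooth_derivation_at msm_component[OF assms(1)]]) (simp add: assms(2))
qed

lemma vder_cong:
  assumes "vsm v" "\<And>x y. x \<in> U \<Longrightarrow> y \<noteq> 0 \<Longrightarrow> v x y = w x y"
  shows "vder \<delta> v x y = vder \<delta> w x y"
  unfolding vder_def
proof (intro arg_cong[where f = vec_lambda] ext)
  fix r
  show "\<delta> (\<lambda>x y. v x y $ r) x y = \<delta> (\<lambda>x y. w x y $ r) x y"
    by (rule derivation_cong[OF smooth_derivation_at vsm_component[OF assms(1)]]) (simp add: assms(2))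
qed

lemma mder_const: "mder \<delta> (\<lambda>x y. C) x y = 0"
  by (simp add: mder_def vec_eq_iff derivation_const[OF smooth_derivation_at])

lemma mder_add: "msm X \<Longrightarrow> msm Y \<Longrightarrow>
    mder \<delta> (\<lambda>x y. X x y + Y x y) x y = mder \<delta> X x y + mder \<delta> Y x y"
  by (simp add: mder_def vec_eq_iff derivation_add[OF smooth_derivation_at] msm_component)

lemma mder_diff: "msm X \<Longrightarrow> msm Y \<Longrightarrow>
    mder \<delta> (\<lambda>x y. X x y - Y x y) x y = mder \<delta> X x y - mder \<delta> Y x y"
  by (simp add: mder_def vec_eq_iff derivation_diff[OF smooth_derivation_at] msm_component)

lemma mder_transpose: "mder \<delta> (\<lambda>x y. transpose (X x y)) x y = transpose (mder \<delta> X x y)"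
  by (simp add: mder_def vec_eq_iff transpose_def)

lemma mder_mult: "msm X \<Longrightarrow> msm Y \<Longrightarrow>
    mder \<delta> (\<lambda>x y. X x y ** Y x y) x y = mder \<delta> X x y ** Y x y + X x y ** mder \<delta> Y x y"
  by (simp add: mder_def vec_eq_iff matrix_matrix_mult_def derivation_sum[OF smooth_derivation_at]
      derivation_mult[OF smooth_derivation_at] msm_component sm_mult sum.distrib)

lemma mder_scaleR: "sm f \<Longrightarrow> msm X \<Longrightarrow>
    mder \<delta> (\<lambda>x y. f x y *\<^sub>R X x y) x y = \<delta> f x y *\<^sub>R X x y + f x y *\<^sub>R mder \<delta> X x y"
  by (simp add: mder_def vec_eq_iff derivation_mult[OF smooth_derivation_at] msm_component)

lemma mder_outer: "vsm u \<Longrightarrow> vsm w \<Longrightarrow>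
    mder \<delta> (\<lambda>x y. outer (u x y) (w x y)) x y
      = outer (vder \<delta> u x y) (w x y) + outer (u x y) (vder \<delta> w x y)"
  by (simp add: mder_def vder_def outer_def vec_eq_iff derivation_mult[OF smooth_derivation_at]
      vsm_component)

lemma vder_mult: "msm X \<Longrightarrow> vsm v \<Longrightarrow>
    vder \<delta> (\<lambda>x y. X x y *v v x y) x y = mder \<delta> X x y *v v x y + X x y *v vder \<delta> v x y"
  by (simp add: mder_def vder_def vec_eq_iff matrix_vector_mult_def
      derivation_sum[OF smooth_derivation_at]
      derivation_mult[OF smooth_derivation_at] msm_component vsm_component sm_mult sum.distrib)

lemma vder_uminus: "vsm v \<Longrightarrow> vder \<delta> (\<lambda>x y. - v x y) x y = - vder \<delta> v x y"
  by (simp add: vder_def vec_eq_iff derivation_uminus[OF smooth_derivation_at] vsm_component)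

lemma der_inner: "vsm v \<Longrightarrow> vsm w \<Longrightarrow>
    \<delta> (\<lambda>x y. v x y \<bullet> w x y) x y = vder \<delta> v x y \<bullet> w x y + v x y \<bullet> vder \<delta> w x y"
  by (simp add: vder_def inner_vec_def derivation_sum[OF smooth_derivation_at]
      derivation_mult[OF smooth_derivation_at] vsm_component sm_mult sum.distrib)

end

end

lemma pdx_mder_commute:
  assumes "msm X" "x \<in> U" "y \<noteq> 0"
  shows "mder (pdx i) (mder (pdx j) X) x y = mder (pdx j) (mder (pdx i) X) x y"
  using pd_commute(1)[OF msm_component[OF assms(1)] assms(2,3)]
  by (simp add: mder_def vec_eq_iff)

end


subsection \<open>Riemannian curvature in matrix form\<close>

text \<open>The connection form: \<open>i\<close> labels the matrix, rows carry the upper index, and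
  columns the index that is contracted with a vector.\<close>

definition christoffel_mat :: "(real^'n \<Rightarrow> real^'n^'n) \<Rightarrow> 'n \<Rightarrow> real^'n \<Rightarrow> real^'n^'n" where
  "christoffel_mat a i x = (\<chi> h l. christoffel a h l i x)"

text \<open>The upper index is the row, against the argument order of \<open>riemann_curv\<close>,
  so that the matrix acts on vectors as a curvature endomorphism.\<close>

definition riemann_mat :: "(real^'n \<Rightarrow> real^'n^'n) \<Rightarrow> 'n \<Rightarrow> 'n \<Rightarrow> real^'n \<Rightarrow> real^'n^'n" where
  "riemann_mat a i j x = (\<chi> r h. riemann_curv a h r i j x)"

locale riemannian_calculus = slit_calculus U for U :: "(real^'n) set" +
  fixes a :: "real^'n \<Rightarrow> real^'n^'n"
  assumes riem: "riemannian_metric U a"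
begin

abbreviation \<Gamma> :: "'n \<Rightarrow> real^'n \<Rightarrow> real^'n^'n" where "\<Gamma> \<equiv> christoffel_mat a"
abbreviation R :: "'n \<Rightarrow> 'n \<Rightarrow> real^'n \<Rightarrow> real^'n^'n" where "R \<equiv> riemann_mat a"

lemma msm_a: "msm (\<lambda>x y. a x)"
  unfolding msm_def
proof (intro allI sm_base)
  fix r c
  have "bounded_linear (\<lambda>A :: real^'n^'n. A $ r $ c)"
    using bounded_linear_compose[OF bounded_linear_vec_nth bounded_linear_vec_nth] .
  then show "smooth_on U (\<lambda>x. a x $ r $ c)"
    using riem Ck_on_linear[OF open_base] unfolding riemannian_metric_def smooth_on_def by blast
qed

lemma pos_def_a: "x \<in> U \<Longrightarrow> pos_def (a x)"
  using riem by (simp add: riemannian_metric_def)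

lemma transpose_a: "x \<in> U \<Longrightarrow> transpose (a x) = a x"
  using pos_def_a by (simp add: pos_def_def)

lemma a_sym:
  assumes "x \<in> U"
  shows "a x $ r $ c = a x $ c $ r"
proof -
  have "transpose (a x) $ c $ r = a x $ c $ r"
    using transpose_a[OF assms] by simp
  then show ?thesis by (simp add: transpose_def)
qed

lemma a_inv:
  assumes "x \<in> U"
  shows "a x ** matrix_inv (a x) = mat 1" "matrix_inv (a x) ** a x = mat 1"
  using matrix_inv_works pos_def_invertible pos_def_a assms by blast+

lemma sm_christoffel: "sm (\<lambda>x y. christoffel a h l i x)"
proof -
  have "msm (\<lambda>x y. matrix_inv (a x))"
    by (rule msm_matrix_inv[OF msm_a]) (simp add: pos_def_invertible pos_def_a)
  note inv = msm_component[OF this]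
  have "sm (\<lambda>x y. 1/2 * (\<Sum>m\<in>UNIV. matrix_inv (a x) $ h $ m *
      (pdx l (\<lambda>x y. a x $ m $ i) x y + pdx i (\<lambda>x y. a x $ m $ l) x y
       - pdx m (\<lambda>x y. a x $ l $ i) x y)))"
    by (intro sm_mult sm_const sm_sum sm_diff sm_add sm_pdx inv msm_component[OF msm_a])
  then show ?thesis by (simp add: christoffel_def pdx_def)
qed

lemma msm_\<Gamma>: "msm (\<lambda>x y. \<Gamma> i x)"
  by (simp add: msm_def christoffel_mat_def sm_christoffel)

lemma pdx_a_sym:
  assumes "x \<in> U" "y \<noteq> 0"
  shows "pdx i (\<lambda>x y. a x $ r $ c) x y = pdx i (\<lambda>x y. a x $ c $ r) x y"
  by (rule derivation_cong[OF derivation_pdx[OF assms] msm_component[OF msm_a]]) (simp add: a_sym)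

lemma christoffel_sym:
  assumes "x \<in> U"
  shows "christoffel a h l i x = christoffel a h i l x"
proof -
  have "partial m (\<lambda>z. a z $ i $ l) x = partial m (\<lambda>z. a z $ l $ i) x" for m
    \<comment> \<open>Functions of \<open>x\<close> alone are differentiated as functions on the
      slit bundle, so some nonzero fibre vector has to be supplied; any axis vector serves.\<close>
    using pdx_a_sym[OF assms, of "axis undefined 1" m] by (simp add: pdx_def)
  then show ?thesis by (simp add: christoffel_def add.commute)
qed

lemma christoffel_low:
  assumes "x \<in> U" "y \<noteq> 0"
  shows "(a x ** \<Gamma> i x) $ h $ l = 1/2 * (pdx l (\<lambda>x y. a x $ h $ i) x y
    + pdx i (\<lambda>x y. a x $ h $ l) x y - pdx h (\<lambda>x y. a x $ l $ i) x y)"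
proof -
  define w where "w = (\<chi> m. 1/2 * (pdx l (\<lambda>x y. a x $ m $ i) x y
    + pdx i (\<lambda>x y. a x $ m $ l) x y - pdx m (\<lambda>x y. a x $ l $ i) x y))"
  have "(a x ** \<Gamma> i x) $ h $ l = (a x *v (matrix_inv (a x) *v w)) $ h"
    by (simp add: matrix_matrix_mult_def matrix_vector_mult_def christoffel_mat_def
        christoffel_def w_def pdx_def sum_distrib_left mult.left_commute)
  also have "\<dots> = w $ h"
    using a_inv[OF assms(1)] by (simp add: matrix_vector_mul_assoc)
  finally show ?thesis by (simp add: w_def)
qed

text \<open>Metric compatibility of the Levi-Civita connection.\<close>

lemma pdx_a:
  assumes "x \<in> U" "y \<noteq> 0"
  shows "mder (pdx i) (\<lambda>x y. a x) x y = a x ** \<Gamma> i x + transpose (\<Gamma> i x) ** a x"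
proof -
  have "transpose (\<Gamma> i x) ** a x = transpose (a x ** \<Gamma> i x)"
    using assms by (simp add: matrix_transpose_mul transpose_a)
  then have "(a x ** \<Gamma> i x + transpose (\<Gamma> i x) ** a x) $ h $ l = pdx i (\<lambda>x y. a x $ h $ l) x y" for h l
    using pdx_a_sym[OF assms, of i h l] pdx_a_sym[OF assms, of _ i]
    by (simp add: transpose_def christoffel_low[OF assms] field_simps)
  then show ?thesis
    by (simp add: mder_def vec_eq_iff)
qed

text \<open>Cartan's structure equation. It holds by unfolding the definitions, hence at every
  \<open>y\<close>, the zero vector included.\<close>

lemma riemann_mat_eq:
  "R i j x = mder (pdx i) (\<lambda>x y. \<Gamma> j x) x y - mder (pdx j) (\<lambda>x y. \<Gamma> i x) x y
    + \<Gamma> i x ** \<Gamma> j x - \<Gamma> j x ** \<Gamma> i x"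
  by (simp add: vec_eq_iff riemann_mat_def riemann_curv_def mder_def pdx_def christoffel_mat_def
      matrix_matrix_mult_def mult.commute)

lemma riemann_mat_fun_eq:
  "(\<lambda>x y. R i j x) = (\<lambda>x y. mder (pdx i) (\<lambda>x y. \<Gamma> j x) x y - mder (pdx j) (\<lambda>x y. \<Gamma> i x) x y
    + \<Gamma> i x ** \<Gamma> j x - \<Gamma> j x ** \<Gamma> i x)"
  by (intro ext) (rule riemann_mat_eq)

lemma riemann_mat_skew: "R j i x = - R i j x"
  unfolding riemann_mat_eq[where y = 0] by simp

lemma msm_R: "msm (\<lambda>x y. R i j x)"
  unfolding riemann_mat_fun_eq
  by (intro msm_diff msm_add msm_mult msm_\<Gamma> msm_mder[OF smooth_derivation_pdx])

text \<open>Computing the two mixed second derivatives of \<open>a\<close> by metric compatibility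
  and subtracting leaves exactly \<open>a R\<close> plus its transpose.\<close>

lemma a_R_skew:
  assumes "x \<in> U"
  shows "transpose (R i j x) ** a x = - (a x ** R i j x)"
proof -
  obtain y :: "real^'n" where y: "y \<noteq> 0" using axis_eq_0_iff[of _ "1::real"] by (metis one_neq_zero)
  have 1: "mder (pdx j) (mder (pdx i) (\<lambda>x y. a x)) x y
    = (a x ** \<Gamma> j x + transpose (\<Gamma> j x) ** a x) ** \<Gamma> i x + a x ** mder (pdx j) (\<lambda>x y. \<Gamma> i x) x y
     + transpose (mder (pdx j) (\<lambda>x y. \<Gamma> i x) x y) ** a x
     + transpose (\<Gamma> i x) ** (a x ** \<Gamma> j x + transpose (\<Gamma> j x) ** a x)" for i j
  proof -
    note D = smooth_derivation_pdx[of j]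
    have "mder (pdx j) (mder (pdx i) (\<lambda>x y. a x)) x y
      = mder (pdx j) (\<lambda>x y. a x ** \<Gamma> i x + transpose (\<Gamma> i x) ** a x) x y"
      by (rule mder_cong[OF D assms y msm_mder[OF smooth_derivation_pdx msm_a]]) (simp add: pdx_a)
    then show ?thesis
      using assms y msm_a msm_\<Gamma>
      by (simp add: mder_add[OF D] mder_mult[OF D] mder_transpose[OF D assms y] msm_mult
          msm_transpose pdx_a)
  qed
  have "mder (pdx i) (mder (pdx j) (\<lambda>x y. a x)) x y - mder (pdx j) (mder (pdx i) (\<lambda>x y. a x)) x y = 0"
    using pdx_mder_commute[OF msm_a assms y] by simp
  then have "a x ** R i j x + transpose (R i j x) ** a x = 0"
    unfolding 1 riemann_mat_eq[where y = y]
    by (simp add: matrix_ring_simps transpose_add transpose_diff matrix_transpose_mul algebra_simps)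
  then show ?thesis by (simp add: add_eq_0_iff)
qed

text \<open>Only the matrix indices are transported; Christoffel terms for the form indices would
  cancel in the cyclic sum by symmetry. The second derivatives of \<Gamma> cancel in pairs, and the
  remaining products by ring algebra.\<close>

lemma bianchi:
  assumes "x \<in> U" "y \<noteq> 0"
  defines "B \<equiv> \<lambda>l i j. mder (pdx l) (\<lambda>x y. R i j x) x y + \<Gamma> l x ** R i j x - R i j x ** \<Gamma> l x"
  shows "B l i j + B j l i + B i j l = 0"
proof -
  have 1: "mder (pdx l) (\<lambda>x y. R i j x) x y
    = mder (pdx l) (mder (pdx i) (\<lambda>x y. \<Gamma> j x)) x y - mder (pdx l) (mder (pdx j) (\<lambda>x y. \<Gamma> i x)) x y
     + mder (pdx l) (\<lambda>x y. \<Gamma> i x) x y ** \<Gamma> j x + \<Gamma> i x ** mder (pdx l) (\<lambda>x y. \<Gamma> j x) x y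
     - mder (pdx l) (\<lambda>x y. \<Gamma> j x) x y ** \<Gamma> i x - \<Gamma> j x ** mder (pdx l) (\<lambda>x y. \<Gamma> i x) x y" for l i j
  proof -
    note D = smooth_derivation_pdx[of l]
    show ?thesis
      unfolding riemann_mat_fun_eq using assms(1,2) msm_\<Gamma>
      by (simp add: mder_add[OF D] mder_diff[OF D] mder_mult[OF D] msm_mult msm_add msm_diff
          msm_mder[OF smooth_derivation_pdx])
  qed
  note c = pdx_mder_commute[OF msm_\<Gamma> assms(1,2)]
  show ?thesis
    unfolding B_def 1
    unfolding riemann_mat_eq[where y = y] c[of l i] c[of l j] c[of j i]
    by (simp add: matrix_ring_simps algebra_simps)
qed

end

section \<open>Fibre coordinates and Euler's relation\<close>

context slit_calculus
begin

lemma sm_fibre_coordinate: "sm (\<lambda>x y. y $ i)"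
  unfolding sm_def smooth_on_def case_prod_unfold
  using bounded_linear_compose[OF bounded_linear_vec_nth bounded_linear_snd]
  by (auto intro!: Ck_on_bounded_linear open_slit_bundle)

lemma pdy_fibre_coordinate: "pdy j (\<lambda>x y. y $ i) x y = (if i = j then 1 else 0)"
proof -
  have "frechet_derivative (\<lambda>y. y $ i) (at y) = (\<lambda>v. v $ i)"
    by (intro frechet_derivative_at[symmetric] bounded_linear_imp_has_derivative
        bounded_linear_vec_nth)
  then show ?thesis by (simp add: pdy_def partial_def axis_def)
qed

lemma pdy_base: "pdy k (\<lambda>x y. f x) x y = 0"
  by (simp add: pdy_def partial_def)

lemma fibre_has_derivative:
  assumes "sm f" "x \<in> U" "y \<noteq> 0"
  shows "(f x has_derivative (\<lambda>v. \<Sum>k\<in>UNIV. v $ k * pdy k f x y)) (at y)"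
proof -
  have "((\<lambda>z. (x, z)) has_derivative (\<lambda>v. (0, v))) (at y)"
    by (auto intro!: derivative_eq_intros)
  from diff_chain_at[OF this sm_has_derivative[OF assms]]
  have D: "(f x has_derivative (\<lambda>v. dd (0, v) f x y)) (at y)"
    by (simp add: o_def)
  have "dd (0, v) f x y = (\<Sum>k\<in>UNIV. v $ k * pdy k f x y)" for v
  proof -
    have "dd (0, v) f x y = dd (0, \<Sum>k\<in>UNIV. v $ k *\<^sub>R axis k 1) f x y"
      using basis_expansion[of v] by (simp add: scalar_mult_eq_scaleR)
    also have "\<dots> = (\<Sum>k\<in>UNIV. v $ k * dd (0, axis k 1) f x y)"
      by (subst linear_sum[OF has_derivative_linear[OF D]],
          subst linear_cmul[OF has_derivative_linear[OF D]]) simp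
    finally show ?thesis using assms by (simp add: pdy_eq_dd)
  qed
  then show ?thesis using D by simp
qed

text \<open>The function \<open>f x (s y)\<close> of \<open>s\<close> is differentiated at
  \<open>s = 1\<close> in two ways, by the chain rule and by homogeneity; the latter applies on the
  open half-line of positive \<open>s\<close>.\<close>

lemma euler_homogeneous:
  assumes "sm f" "x \<in> U" "y \<noteq> 0" "\<And>k. k > 0 \<Longrightarrow> f x (k *\<^sub>R y) = k powr d * f x y"
  shows "(\<Sum>k\<in>UNIV. y $ k * pdy k f x y) = d * f x y"
proof -
  have "((\<lambda>s. s *\<^sub>R y) has_derivative (\<lambda>r. r *\<^sub>R y)) (at (1::real))"
    by (auto intro!: derivative_eq_intros)
  then have "(f x \<circ> (\<lambda>s. s *\<^sub>R y) has_derivative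
      (\<lambda>v. \<Sum>k\<in>UNIV. v $ k * pdy k f x y) \<circ> (\<lambda>r. r *\<^sub>R y)) (at 1)"
    by (rule diff_chain_at) (use fibre_has_derivative[OF assms(1-3)] in simp)
  then have 1: "((\<lambda>s. f x (s *\<^sub>R y)) has_derivative (\<lambda>r. \<Sum>k\<in>UNIV. (r *\<^sub>R y) $ k * pdy k f x y)) (at 1)"
    by (simp add: o_def)
  have "((\<lambda>s. s powr d * f x y) has_real_derivative d * f x y) (at 1)"
    by (auto intro!: derivative_eq_intros)
  then have "((\<lambda>s. s powr d * f x y) has_derivative (\<lambda>r. d * f x y * r)) (at 1)"
    by (simp add: has_field_derivative_def)
  then have "((\<lambda>s. f x (s *\<^sub>R y)) has_derivative (\<lambda>r. d * f x y * r)) (at 1)"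
    by (rule has_derivative_transform_within_open[of _ _ _ _ "{0<..}"]) (use assms(4) in auto)
  from has_derivative_unique[OF 1 this] show ?thesis
    by (auto dest: fun_cong[of _ _ 1])
qed

lemma vder_hor_eq:
  "vder (hor_deriv N i) v x y = vder (pdx i) v x y
    + (\<chi> h k. pdy k (\<lambda>x y. v x y $ h) x y) *v (\<chi> k. N k i x y)"
  by (simp add: vec_eq_iff vder_def hor_deriv_def matrix_vector_mult_def mult.commute)

lemma mder_hor_base: "mder (hor_deriv N i) (\<lambda>x y. X x) x y = mder (pdx i) (\<lambda>x y. X x) x y"
  by (simp add: mder_def hor_deriv_def pdy_base)

end

section \<open>The conformal setting: contractions with y, conformal factor, Jacobian\<close>

locale conformal_calculus = riemannian_calculus U a for U :: "(real^'n) set" and a +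
  fixes F :: "'n fibre_fun" and H :: real and t :: "real^'n \<Rightarrow> real^'n \<Rightarrow> real^'n"
  assumes finsler: "finsler_metric U F"
    and autom: "conformal_automorphism U F a H t"
begin

definition J :: "real^'n \<Rightarrow> real^'n \<Rightarrow> real^'n^'n" where
  "J x y = (\<chi> h k. jac t h k x y)"

definition B :: "real^'n \<Rightarrow> real^'n \<Rightarrow> real^'n^'n" where
  "B x y = (\<chi> n r. jac_inv t n r x y)"

definition \<sigma> :: "real^'n \<Rightarrow> real^'n \<Rightarrow> real" where
  "\<sigma> x y = t x y \<bullet> (a x *v t x y)"

definition covec :: "real^'n \<Rightarrow> real^'n \<Rightarrow> real^'n" where
  "covec x y = (\<chi> k. unit_covec F k x y)"

abbreviation G :: "real^'n \<Rightarrow> real^'n \<Rightarrow> real^'n^'n" where "G \<equiv> metric_tensor F"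

lemma H_pos: "H > 0"
  using autom by (simp add: conformal_automorphism_def)

lemma vsm_t: "vsm (\<lambda>x y. t x y)"
  using autom sm_component by (simp add: vsm_def conformal_automorphism_def)

lemma t_nonzero: "x \<in> U \<Longrightarrow> y \<noteq> 0 \<Longrightarrow> t x y \<noteq> 0"
  using autom bij_betwE unfolding conformal_automorphism_def by fastforce

lemma \<sigma>_pos: "x \<in> U \<Longrightarrow> y \<noteq> 0 \<Longrightarrow> \<sigma> x y > 0"
  using pos_def_a t_nonzero by (simp add: \<sigma>_def pos_def_def)

lemma msm_J: "msm J"
  using vsm_t by (simp add: msm_def vsm_def J_def jac_def sm_pdy)

lemma sm_\<sigma>: "sm \<sigma>"
  unfolding \<sigma>_def[abs_def] using vsm_t msm_a by (intro sm_inner vsm_mult)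

lemma sm_F: "sm F"
  using finsler by (simp add: finsler_metric_def sm_def)

lemma F_pos: "x \<in> U \<Longrightarrow> y \<noteq> 0 \<Longrightarrow> F x y > 0"
  using finsler by (simp add: finsler_metric_def)

lemma pos_def_G: "x \<in> U \<Longrightarrow> y \<noteq> 0 \<Longrightarrow> pos_def (G x y)"
  using finsler by (simp add: finsler_metric_def)

lemma sm_F_square: "sm (\<lambda>x y. (F x y)\<^sup>2)"
  using sm_mult[OF sm_F sm_F] by (simp add: power2_eq_square)

lemma msm_G: "msm G"
  unfolding msm_def metric_tensor_def using sm_F_square by (auto intro!: sm_mult sm_pdy)

lemma pdy_t: "vder (pdy k) t x y = column k (J x y)"
  by (simp add: vec_eq_iff vder_def J_def jac_def column_def)

context
  fixes x y :: "real^'n"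
  assumes x: "x \<in> U" and y: "y \<noteq> 0"
begin

lemma G_sym: "G x y $ i $ j = G x y $ j $ i"
  using pd_commute(2)[OF sm_F_square x y] by (simp add: metric_tensor_def)

lemma transpose_G: "transpose (G x y) = G x y"
  by (simp add: vec_eq_iff transpose_def G_sym)

text \<open>\<open>metric_tensor F\<close> is half the fibre Hessian of \<open>F^2\<close>, so its
  fibre derivatives are third derivatives of one function and symmetric in all indices.\<close>

lemma pdy_G_sym:
  "pdy k (\<lambda>x y. G x y $ m $ h) x y = pdy k (\<lambda>x y. G x y $ h $ m) x y"
  "pdy k (\<lambda>x y. G x y $ m $ h) x y = pdy m (\<lambda>x y. G x y $ k $ h) x y"
proof -
  have e: "pdy k (\<lambda>x y. G x y $ m $ h) x y = 1/2 * pdy k (pdy m (pdy h (\<lambda>x y. (F x y)\<^sup>2))) x y"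
    for k m h
    using derivation_mult[OF derivation_pdy[OF x y] sm_const[of "1/2"]
        sm_pdy[OF sm_pdy[OF sm_F_square]], of k m h]
      derivation_const[OF derivation_pdy[OF x y], of k "1/2"]
    by (simp add: metric_tensor_def)
  show "pdy k (\<lambda>x y. G x y $ m $ h) x y = pdy m (\<lambda>x y. G x y $ k $ h) x y"
    using pd_commute(2)[OF sm_pdy[OF sm_F_square] x y] by (simp add: e)
  show "pdy k (\<lambda>x y. G x y $ m $ h) x y = pdy k (\<lambda>x y. G x y $ h $ m) x y"
    unfolding e
    by (intro arg_cong2[where f = "(*)"] refl derivation_cong[OF derivation_pdy[OF x y]]
        pd_commute(2) sm_pdy sm_F_square)
qed

lemma J_y: "J x y *v y = H *\<^sub>R t x y"
proof -
  have "(\<Sum>k\<in>UNIV. y $ k * pdy k (\<lambda>x y. t x y $ h) x y) = H * t x y $ h" for h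
    using autom x y
    by (intro euler_homogeneous vsm_component[OF vsm_t]) (simp_all add: conformal_automorphism_def)
  then show ?thesis
    by (simp add: vec_eq_iff J_def jac_def matrix_vector_mult_def mult.commute)
qed

lemma F_square_euler: "(\<Sum>j\<in>UNIV. y $ j * pdy j (\<lambda>x y. (F x y)\<^sup>2) x y) = 2 * (F x y)\<^sup>2"
  using finsler x y
  by (intro euler_homogeneous sm_F_square)
    (simp_all add: finsler_metric_def power_mult_distrib powr_numeral)

lemma pdy_F_square: "pdy i (\<lambda>x y. (F x y)\<^sup>2) x y = 2 * F x y * covec x y $ i"
  using derivation_mult[OF derivation_pdy[OF x y] sm_F sm_F, of i]
  by (simp add: power2_eq_square covec_def unit_covec_def)

end

context
  fixes x y :: "real^'n"
  assumes x: "x \<in> U" and y: "y \<noteq> 0"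
begin

text \<open>Differentiating Euler's relation for \<open>F^2\<close> yields the gradient once from
  the factor \<open>y\<close> and twice from the right side; the difference is the Hessian applied
  to \<open>y\<close>.\<close>

lemma G_y: "G x y *v y = F x y *\<^sub>R covec x y"
proof -
  let ?E = "\<lambda>x y. (F x y)\<^sup>2"
  have "(G x y *v y) $ i = F x y * covec x y $ i" for i
  proof -
    note D = derivation_pdy[OF x y, of i]
    have s: "sm (\<lambda>x y. \<Sum>j\<in>UNIV. y $ j * pdy j ?E x y)"
      by (intro sm_sum sm_mult sm_fibre_coordinate sm_pdy sm_F_square)
    have "pdy i (\<lambda>x y. \<Sum>j\<in>UNIV. y $ j * pdy j ?E x y) x y = pdy i (\<lambda>x y. ?E x y + ?E x y) x y"
      by (rule derivation_cong[OF D s]) (simp add: F_square_euler)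
    moreover have "pdy i (\<lambda>x y. ?E x y + ?E x y) x y = pdy i ?E x y + pdy i ?E x y"
      by (rule derivation_add[OF D sm_F_square sm_F_square])
    moreover have "pdy i (\<lambda>x y. \<Sum>j\<in>UNIV. y $ j * pdy j ?E x y) x y
      = (\<Sum>j\<in>UNIV. (if j = i then 1 else 0) * pdy j ?E x y + y $ j * pdy i (pdy j ?E) x y)"
      by (simp add: derivation_sum[OF D] derivation_mult[OF D] sm_fibre_coordinate sm_pdy
          sm_F_square sm_mult pdy_fibre_coordinate cong: if_cong)
    moreover have "\<dots> = pdy i ?E x y + (\<Sum>j\<in>UNIV. y $ j * pdy i (pdy j ?E) x y)"
      by (simp add: sum.distrib if_distrib[of "\<lambda>c. c * _"] cong: if_cong)
    moreover have "(G x y *v y) $ i = 1/2 * (\<Sum>j\<in>UNIV. y $ j * pdy i (pdy j ?E) x y)"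
      by (simp add: metric_tensor_def matrix_vector_mult_def sum_distrib_left mult.commute)
    ultimately show ?thesis using pdy_F_square[OF x y, of i] by simp
  qed
  then show ?thesis by (simp add: vec_eq_iff)
qed

lemma y_G_y: "y \<bullet> (G x y *v y) = (F x y)\<^sup>2"
proof -
  have "2 * (y \<bullet> (G x y *v y)) = (\<Sum>j\<in>UNIV. y $ j * pdy j (\<lambda>x y. (F x y)\<^sup>2) x y)"
    by (simp add: G_y pdy_F_square[OF x y] inner_vec_def sum_distrib_left mult.left_commute
        mult.assoc)
  then show ?thesis by (simp add: F_square_euler[OF x y])
qed

text \<open>Contracting the conformality relation twice with \<open>y\<close> determines the conformal factor.\<close>

lemma G_eq: "G x y = ((F x y)\<^sup>2 / (H\<^sup>2 * \<sigma> x y)) *\<^sub>R (transpose (J x y) ** a x ** J x y)"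
proof -
  obtain p where p: "\<And>m n. G x y $ m $ n =
      (p x y)\<^sup>2 * (\<Sum>i\<in>UNIV. \<Sum>j\<in>UNIV. a x $ i $ j * jac t i m x y * jac t j n x y)"
    using autom x y unfolding conformal_automorphism_def by blast
  define c where "c = (p x y)\<^sup>2"
  have "(\<Sum>i\<in>UNIV. \<Sum>j\<in>UNIV. a x $ i $ j * jac t i m x y * jac t j n x y)
    = (transpose (J x y) ** a x ** J x y) $ m $ n" for m n
    unfolding matrix_matrix_mult_def transpose_def J_def
    by (subst sum.swap) (simp add: sum_distrib_left sum_distrib_right mult_ac)
  then have G: "G x y = c *\<^sub>R (transpose (J x y) ** a x ** J x y)"
    by (simp add: vec_eq_iff p c_def)
  have "(F x y)\<^sup>2 = y \<bullet> (c *\<^sub>R (transpose (J x y) *v (a x *v (J x y *v y))))"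
    unfolding y_G_y[symmetric] G
    by (simp add: matrix_vector_mul_assoc matrix_mul_assoc scaleR_matrix_vector_assoc
        del: transpose_matrix_vector)
  also have "\<dots> = c * (H\<^sup>2 * \<sigma> x y)"
    by (simp add: inner_transpose J_y[OF x y] \<sigma>_def power2_eq_square matrix_vector_mult_scaleR
        mult.assoc del: transpose_matrix_vector)
  finally have "c = (F x y)\<^sup>2 / (H\<^sup>2 * \<sigma> x y)"
    using H_pos \<sigma>_pos[OF x y] by simp
  then show ?thesis using G by simp
qed

text \<open>\<open>J\<close> is a right factor of \<open>G\<close> in \<open>G_eq\<close>, so its
  kernel lies in the kernel of a positive definite matrix.\<close>

lemma invertible_J: "invertible (J x y)"
proof -
  have "v = 0" if "J x y *v v = 0" for v
  proof -
    have "G x y *v v = 0"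
      unfolding G_eq using that
      by (simp flip: matrix_vector_mul_assoc scaleR_matrix_vector_assoc)
    then show ?thesis
      using matrix_inv_works(2)[OF pos_def_invertible[OF pos_def_G[OF x y]]]
      by (metis matrix_vector_mul_assoc matrix_vector_mul_lid matrix_vector_mult_0_right)
  qed
  then show ?thesis
    unfolding invertible_left_inverse matrix_left_invertible_ker by blast
qed

text \<open>The inverse function theorem in the form for a map that is continuous and injective on
  the open slit fibre and has an invertible derivative at \<open>y\<close>. It ties the derivative
  of the global \<open>inv_into\<close> to the matrix inverse.\<close>

lemma B_eq: "B x y = matrix_inv (J x y)"
proof -
  let ?S = "- {0::real^'n}"
  have D: "(t x has_derivative (\<lambda>v. J x y *v v)) (at y)" if "y \<noteq> 0" for y
  proof -
    have "((\<lambda>y. t x y $ h) has_derivative (\<lambda>v. (J x y *v v) $ h)) (at y)" for h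
      using fibre_has_derivative[OF vsm_component[OF vsm_t] x that, of h]
      by (simp add: J_def jac_def matrix_vector_mult_def mult.commute)
    then show ?thesis
      unfolding has_derivative_componentwise_within[of "t x"]
      by (auto simp: Basis_vec_def inner_axis)
  qed
  have inj: "inj_on (t x) ?S"
    using autom x by (auto simp: conformal_automorphism_def bij_betw_def)
  have "(inv_into ?S (t x) has_derivative (\<lambda>v. matrix_inv (J x y) *v v)) (at (t x y))"
  proof (rule has_derivative_inverse_strong[where S = ?S and f = "t x" and x = y])
    show "continuous_on ?S (t x)"
      using D by (intro continuous_at_imp_continuous_on) (auto intro: has_derivative_continuous)
    show "(t x has_derivative (\<lambda>v. J x y *v v)) (at y)"
      using D y by simp
    show "(*v) (J x y) \<circ> (*v) (matrix_inv (J x y)) = id"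
      using matrix_inv_works(1)[OF invertible_J]
      by (simp add: fun_eq_iff matrix_vector_mul_assoc)
  qed (use y inj in auto)
  then have "((\<lambda>\<tau>. inv_into ?S (t x) \<tau> $ k) has_derivative (\<lambda>v. (matrix_inv (J x y) *v v) $ k))
      (at (t x y))" for k
    by (rule bounded_linear.has_derivative[OF bounded_linear_vec_nth])
  from frechet_derivative_at[OF this, symmetric]
  show ?thesis
    by (simp add: vec_eq_iff B_def jac_inv_def partial_def matrix_vector_mult_basis column_def)
qed

lemma J_B: "J x y ** B x y = mat 1"
  and B_J: "B x y ** J x y = mat 1"
  using matrix_inv_works[OF invertible_J] by (simp_all add: B_eq)

end

lemma msm_B: "msm B"
proof -
  have "msm (\<lambda>x y. matrix_inv (J x y))"
    by (rule msm_matrix_inv[OF msm_J invertible_J])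
  then show ?thesis by (rule msm_cong) (simp add: B_eq)
qed

subsection \<open>The connection\<close>

abbreviation N :: "'n \<Rightarrow> 'n \<Rightarrow> 'n fibre_fun" where "N \<equiv> autom_conn a t"

text \<open>The counterpart of \<open>\<Gamma> i\<close> that acts on indices in the
  \<open>y\<close> coordinates.\<close>

definition conn_mat :: "'n \<Rightarrow> real^'n \<Rightarrow> real^'n \<Rightarrow> real^'n^'n" where
  "conn_mat i x y = (\<chi> m k. conn_coeff N m i k x y)"

definition M_vec :: "'n \<Rightarrow> 'n \<Rightarrow> real^'n \<Rightarrow> real^'n \<Rightarrow> real^'n" where
  "M_vec i j x y = (\<chi> n. M_curv N n i j x y)"

lemma N_vec_eq: "(\<chi> k. N k i x y) = - (B x y *v (vder (pdx i) t x y + \<Gamma> i x *v t x y))"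
  by (simp add: vec_eq_iff autom_conn_def B_def vder_def christoffel_mat_def matrix_vector_mult_def)

lemma sm_N: "sm (N k i)"
proof -
  have "vsm (\<lambda>x y. - (B x y *v (vder (pdx i) t x y + \<Gamma> i x *v t x y)))"
    by (intro vsm_uminus vsm_mult msm_B vsm_add vsm_vder[OF smooth_derivation_pdx] vsm_t msm_\<Gamma>)
  then have "vsm (\<lambda>x y. \<chi> k. N k i x y)" unfolding N_vec_eq .
  from vsm_component[OF this, of k] show ?thesis by simp
qed

lemma smooth_derivation_hor_N: "smooth_derivation (hor_deriv N i)"
  by (rule smooth_derivation_hor) (rule sm_N)

lemma vsm_M: "vsm (M_vec i j)"
  unfolding vsm_def M_vec_def M_curv_def[abs_def] using sm_N by (auto intro!: sm_diff sm_hor)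

context
  fixes x y :: "real^'n"
  assumes x: "x \<in> U" and y: "y \<noteq> 0"
begin

lemma hor_t: "vder (hor_deriv N i) t x y = - (\<Gamma> i x *v t x y)"
proof -
  have "vder (hor_deriv N i) t x y = vder (pdx i) t x y + J x y *v (\<chi> k. N k i x y)"
    by (simp add: vder_hor_eq J_def jac_def)
  also have "\<dots> = vder (pdx i) t x y
      - (J x y ** B x y) *v (vder (pdx i) t x y + \<Gamma> i x *v t x y)"
    by (simp add: N_vec_eq matrix_vector_uminus_right matrix_vector_mul_assoc)
  finally show ?thesis by (simp add: J_B[OF x y])
qed

end

context
  fixes x y :: "real^'n"
  assumes x: "x \<in> U" and y: "y \<noteq> 0"
begin

text \<open>Iterating \<open>hor_t\<close> reverses the matrices: the second derivative in the order
  i, j contains \<open>\<Gamma>_j \<Gamma>_i t\<close> with a plus sign. The bracket of the \<Gamma>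
  therefore enters the commutator with the same minus sign as their derivatives.\<close>

lemma J_M: "J x y *v M_vec i j x y = - (R i j x *v t x y)"
proof -
  have 1: "vder (hor_deriv N i) (vder (hor_deriv N j) t) x y
      = - (mder (pdx i) (\<lambda>x y. \<Gamma> j x) x y *v t x y) + \<Gamma> j x *v (\<Gamma> i x *v t x y)" for i j
  proof -
    note D = smooth_derivation_hor_N[of i]
    have "vder (hor_deriv N i) (vder (hor_deriv N j) t) x y
        = vder (hor_deriv N i) (\<lambda>x y. - (\<Gamma> j x *v t x y)) x y"
      by (rule vder_cong[OF D x y vsm_vder[OF smooth_derivation_hor_N vsm_t]]) (simp add: hor_t)
    then show ?thesis
      using msm_\<Gamma> vsm_t
      by (simp add: vder_uminus[OF D x y] vder_mult[OF D x y] vsm_mult hor_t[OF x y]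
          mder_hor_base matrix_vector_uminus_right)
  qed
  have "vder (hor_deriv N i) (vder (hor_deriv N j) t) x y
      - vder (hor_deriv N j) (vder (hor_deriv N i) t) x y = J x y *v M_vec i j x y"
    using hor_commutator[OF sm_N vsm_component[OF vsm_t] x y, where i = i and j = j]
    by (simp add: vec_eq_iff vder_def J_def jac_def M_vec_def matrix_vector_mult_def mult.commute)
  then show ?thesis
    unfolding 1 riemann_mat_eq[where y = y]
    by (simp add: matrix_vector_mul_assoc algebra_simps)
qed

lemma M_eq: "M_vec i j x y = - (B x y *v (R i j x *v t x y))"
proof -
  have "M_vec i j x y = B x y *v (J x y *v M_vec i j x y)"
    by (simp add: matrix_vector_mul_assoc B_J[OF x y])
  then show ?thesis by (simp add: J_M matrix_vector_uminus_right)
qed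

text \<open>The fibre derivative of \<open>hor_t\<close>; commuting it past \<open>hor_deriv\<close>
  produces the \<open>conn_mat\<close> term. In effect \<open>J\<close> is parallel as a map from
  vectors transported by \<open>N\<close> to vectors transported by \<Gamma>.\<close>

lemma hor_J: "mder (hor_deriv N i) J x y = J x y ** conn_mat i x y - \<Gamma> i x ** J x y"
proof -
  have "mder (hor_deriv N i) J x y $ h $ k = (J x y ** conn_mat i x y - \<Gamma> i x ** J x y) $ h $ k" for h k
  proof -
    note D = smooth_derivation_pdy[of k]
    have "vder (pdy k) (vder (hor_deriv N i) t) x y = vder (pdy k) (\<lambda>x y. - (\<Gamma> i x *v t x y)) x y"
      by (rule vder_cong[OF D x y vsm_vder[OF smooth_derivation_hor_N vsm_t]]) (simp add: hor_t)
    also have "\<dots> = - (\<Gamma> i x *v column k (J x y))"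
      using msm_\<Gamma> vsm_t
      by (simp add: vder_uminus[OF D x y] vder_mult[OF D x y] vsm_mult pdy_t)
        (simp add: mder_def pdy_base zero_vec_def[symmetric])
    finally have "pdy k (hor_deriv N i (\<lambda>x y. t x y $ h)) x y = - ((\<Gamma> i x ** J x y) $ h $ k)"
      by (simp add: vder_def vec_eq_iff matrix_vector_mult_def matrix_matrix_mult_def column_def)
    then show ?thesis
      unfolding pdy_hor[OF sm_N vsm_component[OF vsm_t] x y]
      by (simp add: mder_def J_def jac_def conn_mat_def conn_coeff_def
          matrix_matrix_mult_def sum_negf algebra_simps)
  qed
  then show ?thesis by (simp add: vec_eq_iff)
qed

text \<open>Follows from \<open>hor_J\<close> by differentiating
  \<open>J ** B = mat 1\<close>.\<close>

lemma hor_B: "mder (hor_deriv N i) B x y = B x y ** \<Gamma> i x - conn_mat i x y ** B x y"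
proof -
  note D = smooth_derivation_hor_N[of i]
  have "mder (hor_deriv N i) (\<lambda>x y. J x y ** B x y) x y = mder (hor_deriv N i) (\<lambda>x y. mat 1) x y"
    by (rule mder_cong[OF D x y msm_mult[OF msm_J msm_B]]) (simp add: J_B)
  then have "(J x y ** conn_mat i x y - \<Gamma> i x ** J x y) ** B x y
      + J x y ** mder (hor_deriv N i) B x y = 0"
    using msm_J msm_B by (simp add: mder_mult[OF D x y] mder_const[OF D x y] hor_J)
  then have "J x y ** mder (hor_deriv N i) B x y
      = - (J x y ** conn_mat i x y - \<Gamma> i x ** J x y) ** B x y"
    by (simp only: matrix_uminus_left eq_neg_iff_add_eq_0 add.commute)
  then have "(B x y ** J x y) ** mder (hor_deriv N i) B x y
      = B x y ** (- (J x y ** conn_mat i x y - \<Gamma> i x ** J x y) ** B x y)"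
    by (simp flip: matrix_mul_assoc)
  also have "\<dots> = B x y ** \<Gamma> i x ** (J x y ** B x y) - (B x y ** J x y) ** conn_mat i x y ** B x y"
    by (simp add: matrix_ring_simps)
  finally show ?thesis by (simp add: J_B[OF x y] B_J[OF x y])
qed

end


subsection \<open>The Cartan tensor\<close>

text \<open>The value of the conformal factor \<open>p^2\<close> found in
  \<open>G_eq\<close>.\<close>

definition conf :: "real^'n \<Rightarrow> real^'n \<Rightarrow> real" where
  "conf x y = (F x y)\<^sup>2 / (H\<^sup>2 * \<sigma> x y)"

definition cartan_mat :: "'n \<Rightarrow> real^'n \<Rightarrow> real^'n \<Rightarrow> real^'n^'n" where
  "cartan_mat k x y = (\<chi> n h. cartan_tensor F n h k x y)"

text \<open>Half the fibre gradient of \<open>ln conf\<close>, as \<open>pdy_conf\<close> shows; it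
  vanishes for \<open>H = 1\<close>.\<close>

definition q :: "real^'n \<Rightarrow> real^'n \<Rightarrow> real^'n" where
  "q x y = ((1 - H) / F x y) *\<^sub>R covec x y"

definition rho_mat :: "'n \<Rightarrow> 'n \<Rightarrow> real^'n \<Rightarrow> real^'n \<Rightarrow> real^'n^'n" where
  "rho_mat i j x y = (\<chi> n k. rho_curv F N k n i j x y)"

lemma sm_conf: "sm conf"
proof -
  have "H\<^sup>2 * \<sigma> x y \<noteq> 0" if "x \<in> U" "y \<noteq> 0" for x y
    using \<sigma>_pos[OF that] H_pos by simp
  then show ?thesis
    unfolding conf_def[abs_def] by (intro sm_divide sm_mult sm_const sm_\<sigma> sm_F_square) auto
qed

context
  fixes x y :: "real^'n"
  assumes x: "x \<in> U" and y: "y \<noteq> 0"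
begin

lemma conf_works: "conf x y * (H\<^sup>2 * \<sigma> x y) = (F x y)\<^sup>2"
  using \<sigma>_pos[OF x y] H_pos by (simp add: conf_def)

lemma G_conf: "G x y = conf x y *\<^sub>R (transpose (J x y) ** a x ** J x y)"
  by (simp add: G_eq[OF x y] conf_def)

text \<open>The conformality relation contracted once with \<open>y\<close>, using
  \<open>G_y\<close> on one side and \<open>J_y\<close> on the other.\<close>

lemma covec_eq: "covec x y = (F x y / (H * \<sigma> x y)) *\<^sub>R (transpose (J x y) *v (a x *v t x y))"
proof -
  have e: "F x y *\<^sub>R covec x y = (conf x y * H) *\<^sub>R (transpose (J x y) *v (a x *v t x y))"
    using J_y[OF x y]
    by (simp add: G_y[OF x y, symmetric] G_conf matrix_vector_mult_scaleR
        flip: scaleR_matrix_vector_assoc matrix_vector_mul_assoc del: transpose_matrix_vector)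
  have "covec x y = (1 / F x y) *\<^sub>R (F x y *\<^sub>R covec x y)"
    using F_pos[OF x y] by simp
  then have "covec x y = ((conf x y * H) / F x y) *\<^sub>R (transpose (J x y) *v (a x *v t x y))"
    unfolding e by (simp del: transpose_matrix_vector)
  moreover have "(conf x y * H) / F x y = F x y / (H * \<sigma> x y)"
    using F_pos[OF x y] \<sigma>_pos[OF x y] H_pos by (simp add: conf_def power2_eq_square)
  ultimately show ?thesis by simp
qed

lemma pdy_a_t: "vder (pdy k) (\<lambda>x y. a x *v t x y) x y = a x *v column k (J x y)"
  using vsm_t msm_a
  by (simp add: vder_mult[OF smooth_derivation_pdy x y] pdy_t)
    (simp add: mder_def pdy_base zero_vec_def[symmetric])

lemma pdy_\<sigma>: "pdy k \<sigma> x y = 2 * H * \<sigma> x y / F x y * covec x y $ k"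
proof -
  have "t x y \<bullet> (a x *v column k (J x y)) = column k (J x y) \<bullet> (a x *v t x y)"
    using inner_transpose[of "t x y" "a x" "column k (J x y)"] transpose_a[OF x]
    by (simp add: inner_commute del: transpose_matrix_vector)
  then have "pdy k \<sigma> x y = 2 * (column k (J x y) \<bullet> (a x *v t x y))"
    unfolding \<sigma>_def[abs_def] using vsm_t msm_a
    by (simp add: der_inner[OF smooth_derivation_pdy x y] vsm_mult pdy_t pdy_a_t)
  also have "column k (J x y) \<bullet> (a x *v t x y) = (transpose (J x y) *v (a x *v t x y)) $ k"
    by (simp add: column_def inner_vec_def matrix_vector_mult_def transpose_def
        del: transpose_matrix_vector)
  also have "2 * \<dots> = 2 * H * \<sigma> x y / F x y * covec x y $ k"
    using F_pos[OF x y] \<sigma>_pos[OF x y] H_pos by (simp add: covec_eq del: transpose_matrix_vector)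
  finally show ?thesis .
qed

end

context
  fixes x y :: "real^'n"
  assumes x: "x \<in> U" and y: "y \<noteq> 0"
begin

text \<open>Obtained by differentiating the product relation \<open>conf_works\<close>, so that no
  quotient has to be differentiated.\<close>

lemma pdy_conf: "pdy k conf x y = 2 * q x y $ k * conf x y"
proof -
  note D = derivation_pdy[OF x y, of k]
  have "pdy k (\<lambda>x y. conf x y * (H\<^sup>2 * \<sigma> x y)) x y = pdy k (\<lambda>x y. (F x y)\<^sup>2) x y"
    by (rule derivation_cong[OF D]) (auto intro!: sm_mult sm_conf sm_\<sigma> simp: conf_works)
  moreover have "pdy k (\<lambda>x y. H\<^sup>2 * \<sigma> x y) x y = H\<^sup>2 * pdy k \<sigma> x y"
    using derivation_mult[OF D sm_const[of "H\<^sup>2"] sm_\<sigma>] derivation_const[OF D] by simp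
  ultimately have "pdy k conf x y * (H\<^sup>2 * \<sigma> x y)
      + conf x y * (H\<^sup>2 * (2 * H * \<sigma> x y / F x y * covec x y $ k)) = 2 * F x y * covec x y $ k"
    by (simp add: derivation_mult[OF D] sm_conf sm_mult sm_const sm_\<sigma> pdy_F_square[OF x y]
        pdy_\<sigma>[OF x y])
  then have "pdy k conf x y * (H\<^sup>2 * \<sigma> x y)
      + (conf x y * (H\<^sup>2 * \<sigma> x y)) * (2 * H / F x y * covec x y $ k) = 2 * F x y * covec x y $ k"
    by (simp add: mult_ac)
  moreover have "(F x y)\<^sup>2 * (2 * H / F x y * covec x y $ k) = 2 * H * F x y * covec x y $ k"
    using F_pos[OF x y] by (simp add: power2_eq_square)
  ultimately have "pdy k conf x y * (H\<^sup>2 * \<sigma> x y) = 2 * (1 - H) * covec x y $ k * F x y"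
    unfolding conf_works[OF x y] by (simp add: algebra_simps)
  also have "\<dots> = 2 * q x y $ k * conf x y * (H\<^sup>2 * \<sigma> x y)"
    using F_pos[OF x y] conf_works[OF x y] by (simp add: q_def power2_eq_square mult.assoc)
  finally show ?thesis using \<sigma>_pos[OF x y] H_pos by simp
qed

text \<open>The Koszul argument: the total symmetry of \<open>pdy k (metric_tensor F)\<close> turns the derivative of
  the conformality relation into a formula for the second derivatives of \<open>t\<close>.\<close>

lemma half_pdy_G:
  "mder (pdy k) G x y = 2 *\<^sub>R (conf x y *\<^sub>R (transpose (J x y) ** a x ** mder (pdy k) J x y)
    + q x y $ k *\<^sub>R G x y + outer (column k (G x y)) (q x y) - outer (q x y) (column k (G x y)))"
proof -
  define T where "T k = conf x y *\<^sub>R (transpose (J x y) ** a x ** mder (pdy k) J x y)" for k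
  have dG: "mder (pdy k) G x y = (2 * q x y $ k) *\<^sub>R G x y + transpose (T k) + T k" for k
  proof -
    note D = smooth_derivation_pdy[of k]
    have "mder (pdy k) G x y = mder (pdy k) (\<lambda>x y. conf x y *\<^sub>R (transpose (J x y) ** a x ** J x y)) x y"
      by (rule mder_cong[OF D x y msm_G]) (simp add: G_conf)
    also have "\<dots> = (2 * q x y $ k * conf x y) *\<^sub>R (transpose (J x y) ** a x ** J x y)
        + conf x y *\<^sub>R ((transpose (mder (pdy k) J x y) ** a x) ** J x y
          + transpose (J x y) ** a x ** mder (pdy k) J x y)"
      using msm_J msm_a
      by (simp add: mder_scaleR[OF D x y] sm_conf msm_mult msm_transpose mder_mult[OF D x y]
          mder_transpose[OF D x y] pdy_conf)
        (simp add: mder_def pdy_base zero_vec_def[symmetric])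
    finally show ?thesis
      by (simp add: T_def G_conf[OF x y] transpose_scalar matrix_transpose_mul transpose_a[OF x]
          matrix_mul_assoc algebra_simps)
  qed
  \<comment> \<open>Symmetric in \<open>k\<close> and \<open>h\<close> because the entries of the
    derivative of \<open>J\<close> are second fibre derivatives of \<open>t\<close>.\<close>
  have T: "T k $ m $ h = T h $ m $ k" for k m h
    using pd_commute(2)[OF vsm_component[OF vsm_t] x y]
    by (simp add: T_def mder_def J_def jac_def matrix_matrix_mult_def)
  have d: "pdy k (\<lambda>x y. G x y $ m $ h) x y = 2 * q x y $ k * G x y $ m $ h + T k $ h $ m + T k $ m $ h"
    for k m h
    using arg_cong[OF dG[of k], of "\<lambda>X. X $ m $ h"] by (simp add: mder_def transpose_def)
  \<comment> \<open>The relation \<open>d\<close> for (k, m, h) plus that for (h, m, k) minus that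
    for (m, h, k): by total symmetry the left sides combine to one derivative, and by the symmetry
    \<open>T\<close> only twice \<open>T k $ m $ h\<close> is left of the six \<open>T\<close>
    terms.\<close>
  have "pdy k (\<lambda>x y. G x y $ m $ h) x y = 2 * (T k $ m $ h + q x y $ k * G x y $ m $ h
      + q x y $ h * G x y $ m $ k - q x y $ m * G x y $ h $ k)" for m h
    using d[of k m h] d[of h m k] d[of m h k]
      pdy_G_sym(2)[OF x y, of k m h] pdy_G_sym(1)[OF x y, of m k h] pdy_G_sym(2)[OF x y, of m h k]
      pdy_G_sym(1)[OF x y, of h m k]
      T[of k m h] T[of h k m] T[of m h k]
    by (simp add: algebra_simps)
  then show ?thesis
    by (simp add: vec_eq_iff mder_def T_def outer_def column_def algebra_simps)
qed

lemma G_inv: "matrix_inv (G x y) ** G x y = mat 1"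
  using matrix_inv_works(2)[OF pos_def_invertible[OF pos_def_G[OF x y]]] .

text \<open>Raises the index in \<open>half_pdy_G\<close>. The matrix \<open>conf\<close> times
  \<open>transpose J ** a\<close> equals \<open>G ** B\<close>, and \<open>q\<close> is
  \<open>G\<close> applied to a multiple of \<open>y\<close>, so the inverse of \<open>G\<close>
  disappears from the result.\<close>

lemma cartan_mat_eq:
  "cartan_mat k x y = B x y ** mder (pdy k) J x y + q x y $ k *\<^sub>R mat 1 + outer (axis k 1) (q x y)
    - ((1 - H) / (F x y)\<^sup>2) *\<^sub>R outer y (column k (G x y))"
proof -
  let ?I = "matrix_inv (G x y)"
  have 1: "cartan_mat k x y = (1/2) *\<^sub>R (?I ** mder (pdy k) G x y)"
    by (simp add: vec_eq_iff cartan_mat_def cartan_tensor_def mder_def matrix_matrix_mult_def)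
  have 2: "conf x y *\<^sub>R (transpose (J x y) ** a x ** mder (pdy k) J x y)
      = G x y ** (B x y ** mder (pdy k) J x y)"
  proof -
    have "G x y ** (B x y ** mder (pdy k) J x y)
      = conf x y *\<^sub>R (transpose (J x y) ** a x ** (J x y ** B x y) ** mder (pdy k) J x y)"
      by (simp add: G_conf[OF x y] matrix_ring_simps)
    then show ?thesis by (simp add: J_B[OF x y])
  qed
  have 3: "q x y = G x y *v (((1 - H) / (F x y)\<^sup>2) *\<^sub>R y)"
    using F_pos[OF x y] by (simp add: q_def matrix_vector_mult_scaleR G_y[OF x y] power2_eq_square)
  have 4: "?I *v q x y = ((1 - H) / (F x y)\<^sup>2) *\<^sub>R y"
    using G_inv by (simp add: 3 matrix_vector_mul_assoc)
  have 5: "?I *v column k (G x y) = axis k 1"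
    using G_inv by (simp add: matrix_vector_mul_assoc flip: matrix_vector_mult_basis)
  have 6: "?I ** (G x y ** X) = X" for X
    using G_inv by (simp add: matrix_mul_assoc)
  have 7: "outer (c *\<^sub>R u) w = c *\<^sub>R outer u w" for c and u w :: "real^'n"
    by (simp add: vec_eq_iff outer_def)
  show ?thesis
    unfolding 1 half_pdy_G 2
    by (simp add: matrix_add_ldistrib matrix_diff_ldistrib matrix_scaleR_right 6 matrix_mult_outer
        4 5 7 G_inv)
qed

subsection \<open>The curvature tensor\<close>

lemma t_a_R_t: "t x y \<bullet> (a x *v (R i j x *v t x y)) = 0"
proof -
  let ?T = "t x y"
  have "?T \<bullet> (a x *v (R i j x *v ?T)) = ?T \<bullet> (transpose (a x ** R i j x) *v ?T)"
    unfolding inner_transpose by (simp add: matrix_vector_mul_assoc inner_commute)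
  also have "\<dots> = - (?T \<bullet> (a x *v (R i j x *v ?T)))"
    by (simp add: matrix_transpose_mul transpose_a[OF x] a_R_skew[OF x] matrix_vector_uminus_left
        matrix_vector_mul_assoc del: transpose_matrix_vector)
  finally show ?thesis by simp
qed

lemma G_M: "G x y *v M_vec i j x y = - (conf x y *\<^sub>R (transpose (J x y) *v (a x *v (R i j x *v t x y))))"
  using J_M[OF x y, of i j]
  by (simp add: G_conf[OF x y] matrix_vector_uminus_right
      flip: scaleR_matrix_vector_assoc matrix_vector_mul_assoc del: transpose_matrix_vector)

text \<open>The product is a multiple of the expression in \<open>t_a_R_t\<close>, which vanishes by
  skewness. It kills the term \<open>outer (axis k 1) (q x y)\<close> of the Cartan matrix when that
  matrix is applied to \<open>M_vec\<close>.\<close>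

lemma q_M: "q x y \<bullet> M_vec i j x y = 0"
proof -
  have "F x y * (covec x y \<bullet> M_vec i j x y) = (G x y *v y) \<bullet> M_vec i j x y"
    by (simp add: G_y[OF x y])
  also have "\<dots> = y \<bullet> (G x y *v M_vec i j x y)"
    using inner_transpose[of y "G x y"] by (simp add: transpose_G[OF x y] del: transpose_matrix_vector)
  also have "\<dots> = - (conf x y * (y \<bullet> (transpose (J x y) *v (a x *v (R i j x *v t x y)))))"
    by (simp add: G_M del: transpose_matrix_vector)
  also have "y \<bullet> (transpose (J x y) *v (a x *v (R i j x *v t x y))) = 0"
    unfolding inner_transpose J_y[OF x y] by (simp add: t_a_R_t)
  finally show ?thesis using F_pos[OF x y] by (simp add: q_def)
qed

text \<open>The fibre derivative of \<open>J_M\<close> gives the derivative of \<open>M_vec\<close>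
  with a term \<open>B ** mder (pdy k) J\<close> applied to \<open>M_vec\<close>; the same term of
  \<open>cartan_mat_eq\<close> cancels it.\<close>

lemma rho_column:
  "column k (rho_mat i j x y) = B x y *v (R i j x *v column k (J x y)) - q x y $ k *\<^sub>R M_vec i j x y
    + ((1 - H) / (F x y)\<^sup>2 * (G x y *v M_vec i j x y) $ k) *\<^sub>R y"
proof -
  note D = smooth_derivation_pdy[of k]
  have "vder (pdy k) (\<lambda>x y. J x y *v M_vec i j x y) x y = vder (pdy k) (\<lambda>x y. - (R i j x *v t x y)) x y"
    by (rule vder_cong[OF D x y]) (auto intro!: vsm_mult msm_J vsm_M simp: J_M)
  then have "mder (pdy k) J x y *v M_vec i j x y + J x y *v vder (pdy k) (M_vec i j) x y
      = - (R i j x *v column k (J x y))"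
    using msm_J vsm_M msm_R vsm_t
    by (simp add: vder_uminus[OF D x y] vder_mult[OF D x y] vsm_mult pdy_t)
      (simp add: mder_def pdy_base zero_vec_def[symmetric])
  then have e: "J x y *v vder (pdy k) (M_vec i j) x y
      = - (R i j x *v column k (J x y)) - mder (pdy k) J x y *v M_vec i j x y"
    by (simp add: eq_diff_eq add.commute)
  have "B x y *v (J x y *v vder (pdy k) (M_vec i j) x y)
      = B x y *v (- (R i j x *v column k (J x y)) - mder (pdy k) J x y *v M_vec i j x y)"
    by (simp only: e)
  then have dM: "vder (pdy k) (M_vec i j) x y
      = - (B x y *v (R i j x *v column k (J x y))) - (B x y ** mder (pdy k) J x y) *v M_vec i j x y"
    by (simp add: matrix_vector_mul_assoc B_J[OF x y] matrix_vector_mult_diff_distrib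
        matrix_vector_uminus_right)
  have 1: "column k (rho_mat i j x y) = - vder (pdy k) (M_vec i j) x y - cartan_mat k x y *v M_vec i j x y"
    using E_curv_eq_pdy_M_curv[OF sm_N x y]
    by (simp add: vec_eq_iff column_def rho_mat_def rho_curv_def vder_def M_vec_def cartan_mat_def
        matrix_vector_mult_def mult.commute)
  have 2: "column k (G x y) \<bullet> v = (G x y *v v) $ k" for v
    by (simp add: column_def inner_vec_def matrix_vector_mult_def G_sym[OF x y, of _ k])
  show ?thesis
    unfolding 1 dM cartan_mat_eq
    by (simp add: matrix_vector_mult_add_rdistrib matrix_vector_mult_diff_rdistrib outer_mult_vector
        q_M 2 flip: scaleR_matrix_vector_assoc)
qed

end

text \<open>The factor for which \<open>q\<close> equals \<kappa> times \<open>transpose J\<close>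
  applied to \<open>a t\<close>. Since \<open>\<kappa> \<sigma> = 1 / H - 1\<close> is constant,
  \<kappa> is horizontally constant along with \<sigma>.\<close>

definition \<kappa> :: "real^'n \<Rightarrow> real^'n \<Rightarrow> real" where
  "\<kappa> x y = (1 - H) / (H * \<sigma> x y)"

text \<open>\<sigma> times the a-orthogonal projection onto the line of \<open>t\<close>.\<close>

definition P :: "real^'n \<Rightarrow> real^'n \<Rightarrow> real^'n^'n" where
  "P x y = outer (t x y) (a x *v t x y)"

definition Q :: "'n \<Rightarrow> 'n \<Rightarrow> real^'n \<Rightarrow> real^'n \<Rightarrow> real^'n^'n" where
  "Q i j x y = R i j x + \<kappa> x y *\<^sub>R (R i j x ** P x y + P x y ** R i j x)"

context
  fixes x y :: "real^'n"
  assumes x: "x \<in> U" and y: "y \<noteq> 0"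
begin

lemma rho_mat_eq: "rho_mat i j x y = B x y ** Q i j x y ** J x y"
proof -
  let ?t = "t x y" and ?A = "a x" and ?R = "R i j x" and ?B = "B x y" and ?J = "J x y"
  have "rho_mat i j x y = ?B ** ?R ** ?J - outer (M_vec i j x y) (q x y)
      + ((1 - H) / (F x y)\<^sup>2) *\<^sub>R outer y (G x y *v M_vec i j x y)"
    (is "_ = ?rhs")
  proof -
    have c: "(X ** ?J) $ n $ k = (X *v column k ?J) $ n" for X n k
      by (simp add: column_def matrix_vector_mult_def matrix_matrix_mult_def)
    have "column k (rho_mat i j x y) $ n = ?rhs $ n $ k" for n k
      unfolding rho_column[OF x y]
      by (simp add: outer_def matrix_vector_mul_assoc c mult_ac)
    then show ?thesis by (simp add: vec_eq_iff column_def)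
  qed
  moreover have "outer (M_vec i j x y) (q x y) = - (\<kappa> x y *\<^sub>R (?B ** (?R ** P x y) ** ?J))"
  proof -
    have "q x y = \<kappa> x y *\<^sub>R (transpose ?J *v (?A *v ?t))"
      using F_pos[OF x y] by (simp add: q_def covec_eq[OF x y] \<kappa>_def del: transpose_matrix_vector)
    then show ?thesis
      by (simp add: M_eq[OF x y] P_def matrix_mult_outer outer_mult_matrix del: transpose_matrix_vector)
        (simp add: outer_def vec_eq_iff)
  qed
  moreover have "((1 - H) / (F x y)\<^sup>2) *\<^sub>R outer y (G x y *v M_vec i j x y)
      = \<kappa> x y *\<^sub>R (?B ** (P x y ** ?R) ** ?J)"
  proof -
    have "y = ?B *v (?J *v y)" by (simp add: matrix_vector_mul_assoc B_J[OF x y])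
    then have yB: "y = H *\<^sub>R (?B *v ?t)" by (simp add: J_y[OF x y] matrix_vector_mult_scaleR)
    have c: "(1 - H) / (F x y)\<^sup>2 * H * conf x y = \<kappa> x y"
      using F_pos[OF x y] H_pos \<sigma>_pos[OF x y] by (simp add: conf_def \<kappa>_def power2_eq_square)
    \<comment> \<open>Skewness moves \<open>R\<close> across \<open>a\<close>; this lets the
      covector \<open>a R t\<close> be read off from \<open>P ** R\<close>.\<close>
    have "transpose ?R *v (?A *v ?t) = - (?A *v (?R *v ?t))"
      using a_R_skew[OF x, of i j]
      by (simp add: matrix_vector_mul_assoc matrix_vector_uminus_left del: transpose_matrix_vector)
    then have "?B ** (P x y ** ?R) ** ?J
        = - outer (?B *v ?t) (transpose ?J *v (?A *v (?R *v ?t)))"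
      by (simp add: P_def matrix_mult_outer outer_mult_matrix matrix_vector_uminus_right
          del: transpose_matrix_vector) (simp add: outer_def vec_eq_iff)
    moreover have "((1 - H) / (F x y)\<^sup>2) *\<^sub>R outer y (G x y *v M_vec i j x y)
        = - (((1 - H) / (F x y)\<^sup>2 * H * conf x y) *\<^sub>R
            outer (?B *v ?t) (transpose ?J *v (?A *v (?R *v ?t))))"
      unfolding G_M[OF x y] by (subst yB) (simp add: outer_def vec_eq_iff)
    ultimately show ?thesis unfolding c by simp
  qed
  ultimately show ?thesis
    by (simp add: Q_def matrix_ring_simps scaleR_add_right)
qed

lemma P_transpose: "transpose (P x y) ** a x = a x ** P x y"
  by (simp add: P_def transpose_outer outer_mult_matrix matrix_mult_outer transpose_a[OF x]
      del: transpose_matrix_vector)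

lemma a_Q_skew: "transpose (Q i j x y) ** a x = - (a x ** Q i j x y)"
proof -
  let ?R = "R i j x" and ?P = "P x y" and ?A = "a x"
  have 1: "transpose ?P ** transpose ?R ** ?A = - (?A ** ?P ** ?R)"
    by (simp add: a_R_skew[OF x] matrix_uminus_right P_transpose
        flip: matrix_mul_assoc) (simp add: P_transpose matrix_mul_assoc)
  have 2: "transpose ?R ** transpose ?P ** ?A = - (?A ** ?R ** ?P)"
    using a_R_skew[OF x, of i j]
    by (simp add: P_transpose flip: matrix_mul_assoc) (simp add: matrix_mul_assoc matrix_uminus_left)
  show ?thesis
    by (simp add: Q_def transpose_add transpose_scalar matrix_transpose_mul matrix_ring_simps 1 2
        a_R_skew[OF x] scaleR_add_right algebra_simps)
qed

end


subsection \<open>The cyclic identity\<close>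

context
  fixes x y :: "real^'n"
  assumes x: "x \<in> U" and y: "y \<noteq> 0"
begin

lemma hor_a_t: "vder (hor_deriv N l) (\<lambda>x y. a x *v t x y) x y = transpose (\<Gamma> l x) *v (a x *v t x y)"
  using msm_a vsm_t
  by (simp add: vder_mult[OF smooth_derivation_hor_N x y] mder_hor_base pdx_a[OF x y] hor_t[OF x y]
      matrix_vector_uminus_right matrix_vector_mult_add_rdistrib matrix_vector_mul_assoc
      del: transpose_matrix_vector)

text \<open>Levi-Civita transport preserves lengths: the \<Gamma> terms of \<open>hor_t\<close> and
  \<open>hor_a_t\<close> are adjoint to each other and of opposite sign.\<close>

lemma hor_\<sigma>: "hor_deriv N l \<sigma> x y = 0"
  unfolding \<sigma>_def[abs_def] using msm_a vsm_t
  by (simp add: der_inner[OF smooth_derivation_hor_N x y] vsm_mult hor_a_t hor_t[OF x y]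
      inner_transpose del: transpose_matrix_vector)

lemma hor_P: "mder (hor_deriv N l) P x y = P x y ** \<Gamma> l x - \<Gamma> l x ** P x y"
proof -
  have "outer (- u) w = - outer u w" for u w :: "real^'n"
    by (simp add: outer_def vec_eq_iff)
  then show ?thesis
    unfolding P_def[abs_def] using msm_a vsm_t
    by (simp add: mder_outer[OF smooth_derivation_hor_N x y] vsm_mult hor_a_t hor_t[OF x y]
        outer_mult_matrix matrix_mult_outer del: transpose_matrix_vector)
qed

end

text \<open>The first lower index is the row, whereas \<open>rho_mat\<close> has its upper index
  there; lowering thus involves a transposition, which \<open>a_Q_skew\<close> turns into the minus
  sign of \<open>rho_low_mat_eq\<close>.\<close>

definition rho_low_mat :: "'n \<Rightarrow> 'n \<Rightarrow> real^'n \<Rightarrow> real^'n \<Rightarrow> real^'n^'n" where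
  "rho_low_mat i j x y = (\<chi> k n. rho_low F N k n i j x y)"

definition riemann_low_mat :: "'n \<Rightarrow> 'n \<Rightarrow> real^'n \<Rightarrow> real^'n^'n" where
  "riemann_low_mat i j x = (\<chi> k n. riemann_low a k n i j x)"

lemma sm_\<kappa>: "sm \<kappa>"
proof -
  have "H * \<sigma> x y \<noteq> 0" if "x \<in> U" "y \<noteq> 0" for x y
    using \<sigma>_pos[OF that] H_pos by simp
  then show ?thesis
    unfolding \<kappa>_def[abs_def] by (intro sm_divide sm_mult sm_const sm_\<sigma>) auto
qed

lemma msm_P: "msm P"
  unfolding P_def[abs_def] by (intro msm_outer vsm_mult vsm_t msm_a)

lemma msm_Q: "msm (Q i j)"
  unfolding Q_def[abs_def] by (intro msm_add msm_scaleR msm_mult msm_R msm_P sm_\<kappa>)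

lemma Q_skew: "Q j i x y = - Q i j x y"
  by (simp add: Q_def riemann_mat_skew[of j i] matrix_uminus_left matrix_uminus_right
      scaleR_right_diff_distrib scaleR_add_right)

context
  fixes x y :: "real^'n"
  assumes x: "x \<in> U" and y: "y \<noteq> 0"
begin

lemma hor_\<kappa>: "hor_deriv N l \<kappa> x y = 0"
proof -
  note D = derivation_hor[OF x y, of N l]
  have "hor_deriv N l (\<lambda>x y. \<kappa> x y * \<sigma> x y) x y = hor_deriv N l (\<lambda>x y. (1 - H) / H) x y"
  proof (rule derivation_cong[OF D])
    show "\<kappa> x y * \<sigma> x y = (1 - H) / H" if "x \<in> U" "y \<noteq> 0" for x y
      using \<sigma>_pos[OF that] H_pos by (simp add: \<kappa>_def)
  qed (intro sm_mult sm_\<kappa> sm_\<sigma>)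
  then show ?thesis
    using \<sigma>_pos[OF x y]
    by (simp add: derivation_mult[OF D] derivation_const[OF D] sm_\<kappa> sm_\<sigma> hor_\<sigma>[OF x y])
qed

text \<open>With \<kappa> and \<open>P\<close> parallel, the covariant derivative falls on
  \<open>R\<close> alone.\<close>

lemma hor_Q:
  defines "S \<equiv> \<lambda>l i j. mder (pdx l) (\<lambda>x y. R i j x) x y + \<Gamma> l x ** R i j x - R i j x ** \<Gamma> l x"
  shows "mder (hor_deriv N l) (Q i j) x y + \<Gamma> l x ** Q i j x y - Q i j x y ** \<Gamma> l x
    = S l i j + \<kappa> x y *\<^sub>R (S l i j ** P x y + P x y ** S l i j)"
proof -
  note D = smooth_derivation_hor_N[of l]
  have "mder (hor_deriv N l) (Q i j) x y = mder (pdx l) (\<lambda>x y. R i j x) x y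
    + \<kappa> x y *\<^sub>R (mder (pdx l) (\<lambda>x y. R i j x) x y ** P x y
        + R i j x ** (P x y ** \<Gamma> l x - \<Gamma> l x ** P x y)
        + ((P x y ** \<Gamma> l x - \<Gamma> l x ** P x y) ** R i j x
        + P x y ** mder (pdx l) (\<lambda>x y. R i j x) x y))"
    unfolding Q_def[abs_def] using sm_\<kappa> msm_R msm_P
    by (simp add: mder_add[OF D x y] mder_scaleR[OF D x y] mder_mult[OF D x y] msm_add msm_mult
        msm_scaleR hor_\<kappa> hor_P[OF x y] mder_hor_base)
  then show ?thesis
    by (simp add: Q_def S_def matrix_ring_simps algebra_simps)
qed

text \<open>\<open>hor_B\<close> and \<open>hor_J\<close> exchange the transport by
  \<open>conn_mat\<close> outside for the transport by \<Gamma> inside.\<close>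

lemma hor_rho:
  "mder (hor_deriv N l) (rho_mat i j) x y + conn_mat l x y ** rho_mat i j x y
      - rho_mat i j x y ** conn_mat l x y
    = B x y ** (mder (hor_deriv N l) (Q i j) x y + \<Gamma> l x ** Q i j x y - Q i j x y ** \<Gamma> l x) ** J x y"
proof -
  note D = smooth_derivation_hor_N[of l]
  have "mder (hor_deriv N l) (\<lambda>x y. B x y ** Q i j x y ** J x y) x y = mder (hor_deriv N l) (rho_mat i j) x y"
    by (rule mder_cong[OF D x y]) (auto intro!: msm_mult msm_B msm_Q msm_J simp: rho_mat_eq)
  then have "mder (hor_deriv N l) (rho_mat i j) x y
    = ((B x y ** \<Gamma> l x - conn_mat l x y ** B x y) ** Q i j x y
        + B x y ** mder (hor_deriv N l) (Q i j) x y) ** J x y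
      + B x y ** Q i j x y ** (J x y ** conn_mat l x y - \<Gamma> l x ** J x y)"
    using msm_B msm_Q msm_J
    by (simp add: mder_mult[OF D x y] msm_mult hor_B[OF x y] hor_J[OF x y])
  then show ?thesis
    by (simp add: rho_mat_eq[OF x y] matrix_ring_simps algebra_simps)
qed

lemma rho_mat_skew: "rho_mat j i x y = - rho_mat i j x y"
  by (simp add: rho_mat_eq[OF x y] Q_skew[of j i] matrix_uminus_left matrix_uminus_right)

lemma cyclic_identity:
  "cov_deriv a N l (rho_curv F N) k n i j x y + cov_deriv a N j (rho_curv F N) k n l i x y
    + cov_deriv a N i (rho_curv F N) k n j l x y = 0"
proof -
  define S where "S l i j = mder (pdx l) (\<lambda>x y. R i j x) x y + \<Gamma> l x ** R i j x - R i j x ** \<Gamma> l x"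
    for l i j
  \<comment> \<open>\<open>V\<close> collects the derivative and the terms for the two vector
    indices, \<open>W\<close> the Christoffel terms for a form index.\<close>
  define V where "V l i j = mder (hor_deriv N l) (rho_mat i j) x y + conn_mat l x y ** rho_mat i j x y
      - rho_mat i j x y ** conn_mat l x y" for l i j
  define W where "W l i j = (\<Sum>s\<in>UNIV. christoffel a s l i x * rho_mat s j x y $ n $ k)" for l i j
  have V: "V l i j = B x y ** (S l i j + \<kappa> x y *\<^sub>R (S l i j ** P x y + P x y ** S l i j)) ** J x y"
    for l i j
    unfolding V_def hor_rho hor_Q S_def ..
  have S: "S l i j + S j l i + S i j l = 0"
    unfolding S_def by (rule bianchi[OF x y])
  have "V l i j + V j l i + V i j l = B x y ** ((S l i j + S j l i + S i j l)
      + \<kappa> x y *\<^sub>R ((S l i j + S j l i + S i j l) ** P x y + P x y ** (S l i j + S j l i + S i j l))) ** J x y"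
    unfolding V by (simp add: matrix_ring_simps scaleR_add_right algebra_simps)
  also have "\<dots> = 0"
    unfolding S by (simp add: matrix_matrix_mult_def vec_eq_iff)
  finally have V0: "V l i j $ n $ k + V j l i $ n $ k + V i j l $ n $ k = 0"
    by (metis vector_add_component zero_index)
  have c: "cov_deriv a N l (rho_curv F N) k n i j x y = V l i j $ n $ k - W l i j + W l j i" for l i j
  proof -
    \<comment> \<open>Skewness in the form indices rewrites the second Christoffel sum as a
      \<open>W\<close> of the same shape as the first.\<close>
    have "(\<Sum>s\<in>UNIV. christoffel a s l j x * rho_mat i s x y $ n $ k) = - W l j i"
      unfolding W_def sum_negf[symmetric]
      by (rule sum.cong[OF refl]) (subst rho_mat_skew, simp)
    moreover have "hor_deriv N l (rho_curv F N k n i j) x y = mder (hor_deriv N l) (rho_mat i j) x y $ n $ k"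
      by (simp add: mder_def rho_mat_def)
    ultimately show ?thesis
      unfolding cov_deriv_def V_def W_def
      by (simp add: conn_mat_def rho_mat_def matrix_matrix_mult_def mult.commute)
  qed
  \<comment> \<open>Absence of torsion: with this symmetry the six \<open>W\<close> terms of the
    cyclic sum cancel in pairs.\<close>
  have W: "W l i j = W i l j" for l i j
    unfolding W_def by (simp add: christoffel_sym[OF x, of _ l i])
  show ?thesis
    unfolding c using V0 W[of l i j] W[of l j i] W[of j i l] by simp
qed

subsection \<open>The quadratic invariant\<close>

lemma transpose_a_inv: "transpose (matrix_inv (a x)) = matrix_inv (a x)"
proof -
  have "a x ** transpose (matrix_inv (a x)) = mat 1"
    using arg_cong[OF a_inv(2)[OF x], of transpose] unfolding matrix_transpose_mul
    by (simp add: transpose_a[OF x])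
  from matrix_inv_unique[OF this] show ?thesis by (rule sym)
qed

lemma conf_pos: "conf x y > 0"
  using F_pos[OF x y] \<sigma>_pos[OF x y] H_pos by (simp add: conf_def)

lemma B_J_transpose: "transpose (B x y) ** transpose (J x y) = mat 1"
  and J_B_transpose: "transpose (J x y) ** transpose (B x y) = mat 1"
  using J_B[OF x y] B_J[OF x y] by (simp_all flip: matrix_transpose_mul)

lemma matrix_inv_G:
  "matrix_inv (G x y) = (1 / conf x y) *\<^sub>R (B x y ** matrix_inv (a x) ** transpose (B x y))"
proof (rule matrix_inv_unique)
  have "G x y ** ((1 / conf x y) *\<^sub>R (B x y ** matrix_inv (a x) ** transpose (B x y)))
    = transpose (J x y) ** (a x ** (J x y ** B x y) ** matrix_inv (a x)) ** transpose (B x y)"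
    using conf_pos by (simp add: G_conf[OF x y] matrix_ring_simps)
  then show "G x y ** ((1 / conf x y) *\<^sub>R (B x y ** matrix_inv (a x) ** transpose (B x y))) = mat 1"
    by (simp add: J_B[OF x y] a_inv[OF x] J_B_transpose)
qed

lemma rho_low_mat_eq: "rho_low_mat i j x y = - (conf x y *\<^sub>R (transpose (J x y) ** a x ** Q i j x y ** J x y))"
proof -
  have "rho_low_mat i j x y = transpose (rho_mat i j x y) ** G x y"
    by (simp add: rho_low_mat_def rho_low_def rho_mat_def vec_eq_iff matrix_matrix_mult_def
        transpose_def mult.commute)
  also have "\<dots> = conf x y *\<^sub>R (transpose (J x y) ** transpose (Q i j x y)
      ** (transpose (B x y) ** transpose (J x y)) ** a x ** J x y)"
    by (simp add: rho_mat_eq[OF x y] G_conf[OF x y] matrix_transpose_mul matrix_ring_simps)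
  also have "\<dots> = conf x y *\<^sub>R (transpose (J x y) ** (transpose (Q i j x y) ** a x) ** J x y)"
    by (simp add: B_J_transpose matrix_mul_assoc)
  also have "\<dots> = - (conf x y *\<^sub>R (transpose (J x y) ** a x ** Q i j x y ** J x y))"
    unfolding a_Q_skew[OF x y] by (simp add: matrix_ring_simps)
  finally show ?thesis .
qed

lemma transpose_rho_low_mat: "transpose (rho_low_mat i j x y) = - rho_low_mat i j x y"
proof -
  have "transpose (rho_low_mat i j x y)
    = - (conf x y *\<^sub>R (transpose (J x y) ** (transpose (Q i j x y) ** a x) ** J x y))"
    by (simp add: rho_low_mat_eq transpose_uminus transpose_scalar matrix_transpose_mul
        transpose_a[OF x] matrix_mul_assoc)
  then show ?thesis
    unfolding a_Q_skew[OF x y] rho_low_mat_eq by (simp add: matrix_ring_simps)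
qed

lemma rho_low_skew:
  "rho_low F N m n i j x y = - rho_low F N n m i j x y"
  "rho_low F N m n i j x y = - rho_low F N m n j i x y"
proof -
  have "transpose (rho_low_mat i j x y) $ n $ m = - rho_low_mat i j x y $ n $ m"
    by (simp add: transpose_rho_low_mat)
  then show "rho_low F N m n i j x y = - rho_low F N n m i j x y"
    by (simp add: rho_low_mat_def transpose_def)
  have "rho_low_mat i j x y = - rho_low_mat j i x y"
    by (simp add: rho_low_mat_eq Q_skew[of i j] matrix_uminus_left matrix_uminus_right)
  then have "rho_low_mat i j x y $ m $ n = - rho_low_mat j i x y $ m $ n" by simp
  then show "rho_low F N m n i j x y = - rho_low F N m n j i x y"
    by (simp add: rho_low_mat_def)
qed

text \<open>\<open>conf\<close> cancels between each inverse metric and the lowered tensor, and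
  conjugation by \<open>B\<close> and \<open>J\<close> drops out of the trace. The sign comes from
  transposing the skew second factor.\<close>

lemma rho_trace:
  "trace (matrix_inv (G x y) ** rho_low_mat r s x y ** transpose (matrix_inv (G x y))
      ** transpose (rho_low_mat i j x y)) = - trace (Q r s x y ** Q i j x y)"
proof -
  let ?I = "matrix_inv (G x y)"
  have 1: "?I ** rho_low_mat i j x y = - (B x y ** Q i j x y ** J x y)" for i j
  proof -
    have "?I ** rho_low_mat i j x y = - (B x y ** (matrix_inv (a x) **
        (transpose (B x y) ** transpose (J x y)) ** a x) ** Q i j x y ** J x y)"
      using conf_pos by (simp add: matrix_inv_G rho_low_mat_eq matrix_ring_simps)
    then show ?thesis by (simp add: B_J_transpose a_inv[OF x])
  qed
  have 2: "transpose ?I = ?I"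
    by (simp add: matrix_inv_G transpose_scalar matrix_transpose_mul transpose_a_inv matrix_mul_assoc)
  have "?I ** rho_low_mat r s x y ** transpose ?I ** transpose (rho_low_mat i j x y)
    = (?I ** rho_low_mat r s x y) ** (?I ** - rho_low_mat i j x y)"
    by (simp add: 2 transpose_rho_low_mat matrix_mul_assoc)
  also have "\<dots> = - (B x y ** (Q r s x y ** (J x y ** B x y) ** Q i j x y ** J x y))"
    by (simp add: 1 matrix_uminus_right matrix_uminus_left) (simp add: matrix_mul_assoc)
  finally have "trace (?I ** rho_low_mat r s x y ** transpose ?I ** transpose (rho_low_mat i j x y))
    = - trace (B x y ** (Q r s x y ** Q i j x y ** J x y))"
    by (simp add: J_B[OF x y] trace_def sum_negf)
  also have "trace (B x y ** (Q r s x y ** Q i j x y ** J x y))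
    = trace (Q r s x y ** Q i j x y ** (J x y ** B x y))"
    by (subst trace_mul_sym) (simp add: matrix_mul_assoc)
  finally show ?thesis by (simp add: J_B[OF x y])
qed

lemma riemann_low_mat_eq: "riemann_low_mat i j x = - (a x ** R i j x)"
proof -
  have "riemann_low_mat i j x = transpose (a x ** R i j x)"
    by (simp add: riemann_low_mat_def riemann_low_def riemann_mat_def vec_eq_iff
        matrix_matrix_mult_def transpose_def)
  then show ?thesis by (simp add: matrix_transpose_mul transpose_a[OF x] a_R_skew[OF x])
qed

lemma transpose_riemann_low_mat: "transpose (riemann_low_mat i j x) = a x ** R i j x"
  by (simp add: riemann_low_mat_eq transpose_uminus matrix_transpose_mul transpose_a[OF x]
      a_R_skew[OF x])

lemma riemann_trace:
  "trace (matrix_inv (a x) ** riemann_low_mat r s x ** transpose (matrix_inv (a x))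
      ** transpose (riemann_low_mat i j x)) = - trace (R r s x ** R i j x)"
proof -
  have "matrix_inv (a x) ** riemann_low_mat r s x ** transpose (matrix_inv (a x))
      ** transpose (riemann_low_mat i j x)
    = - ((matrix_inv (a x) ** a x) ** R r s x ** ((matrix_inv (a x) ** a x) ** R i j x))"
    unfolding transpose_riemann_low_mat unfolding riemann_low_mat_eq transpose_a_inv
    by (simp add: matrix_ring_simps)
  then show ?thesis by (simp add: a_inv[OF x] trace_def sum_negf)
qed

lemma t_R_R_t:
  "t x y \<bullet> ((riemann_low_mat r s x ** transpose (matrix_inv (a x)) ** transpose (riemann_low_mat i j x)) *v t x y)
    = - trace (P x y ** (R r s x ** R i j x))"
proof -
  have "riemann_low_mat r s x ** transpose (matrix_inv (a x)) ** transpose (riemann_low_mat i j x)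
    = - (a x ** (R r s x ** ((matrix_inv (a x) ** a x) ** R i j x)))"
    unfolding transpose_riemann_low_mat unfolding riemann_low_mat_eq transpose_a_inv
    by (simp add: matrix_ring_simps)
  then have "t x y \<bullet> ((riemann_low_mat r s x ** transpose (matrix_inv (a x))
      ** transpose (riemann_low_mat i j x)) *v t x y)
    = - (t x y \<bullet> (a x *v ((R r s x ** R i j x) *v t x y)))"
    by (simp add: a_inv[OF x] matrix_vector_uminus_left matrix_vector_mul_assoc)
  also have "t x y \<bullet> (a x *v ((R r s x ** R i j x) *v t x y))
    = ((R r s x ** R i j x) *v t x y) \<bullet> (a x *v t x y)"
    using inner_transpose[of "t x y" "a x"]
    by (simp add: transpose_a[OF x] inner_commute del: transpose_matrix_vector)
  also have "\<dots> = trace (P x y ** (R r s x ** R i j x))"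
    by (subst trace_mul_sym) (simp add: P_def matrix_mult_outer trace_outer)
  finally show ?thesis .
qed

text \<open>Transpose and conjugate by \<open>a\<close>: relative to \<open>a\<close>,
  \<open>P\<close> is self-adjoint and both curvature matrices are skew, so the order reverses and
  the two signs cancel.\<close>

lemma trace_P_commute: "trace (P x y ** (R r s x ** R i j x)) = trace (P x y ** (R i j x ** R r s x))"
proof -
  have "trace (P x y ** (R r s x ** R i j x)) = trace (transpose (P x y ** (R r s x ** R i j x)))"
    by (simp add: trace_def transpose_def)
  also have "transpose (P x y ** (R r s x ** R i j x))
    = transpose (R i j x) ** transpose (R r s x) ** (transpose (P x y) ** a x) ** matrix_inv (a x)"
    using a_inv[OF x] by (simp add: matrix_transpose_mul flip: matrix_mul_assoc)
  also have "\<dots> = transpose (R i j x) ** (transpose (R r s x) ** a x) ** P x y ** matrix_inv (a x)"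
    unfolding P_transpose[OF x y] by (simp add: matrix_mul_assoc)
  also have "\<dots> = a x ** (R i j x ** R r s x ** P x y ** matrix_inv (a x))"
    unfolding a_R_skew[OF x] by (simp add: matrix_ring_simps a_R_skew[OF x])
  also have "trace \<dots> = trace (R i j x ** R r s x ** P x y ** (matrix_inv (a x) ** a x))"
    by (subst trace_mul_sym) (simp add: matrix_mul_assoc)
  also have "\<dots> = trace (P x y ** (R i j x ** R r s x))"
    unfolding a_inv[OF x] by (subst trace_mul_sym) simp
  finally show ?thesis .
qed

lemma P_P: "P x y ** P x y = \<sigma> x y *\<^sub>R P x y"
  by (simp add: P_def matrix_mult_outer outer_mult_vector \<sigma>_def inner_commute)
    (simp add: outer_def vec_eq_iff)

lemma P_R_P: "P x y ** R i j x ** P x y = 0"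
proof -
  have "P x y ** (R i j x ** P x y) = outer (((a x *v t x y) \<bullet> (R i j x *v t x y)) *\<^sub>R t x y) (a x *v t x y)"
    by (simp add: P_def matrix_mult_outer outer_mult_vector)
  also have "(a x *v t x y) \<bullet> (R i j x *v t x y) = t x y \<bullet> (a x *v (R i j x *v t x y))"
    using inner_transpose[of "t x y" "a x"] by (simp add: transpose_a[OF x] del: transpose_matrix_vector)
  finally show ?thesis
    by (simp add: t_a_R_t[OF x y] outer_def vec_eq_iff matrix_mul_assoc)
qed

lemma trace_Q_Q:
  "trace (Q r s x y ** Q i j x y) = trace (R r s x ** R i j x)
    + 2 / \<sigma> x y * (1 / H\<^sup>2 - 1) * trace (P x y ** (R r s x ** R i j x))"
proof -
  let ?P = "P x y" and ?X = "R r s x" and ?Y = "R i j x" and ?k = "\<kappa> x y"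
  have e: "Q r s x y ** Q i j x y = ?X ** ?Y
      + ?k *\<^sub>R ((?X ** ?Y) ** ?P + ?X ** (?P ** ?Y) + ?X ** (?P ** ?Y) + ?P ** (?X ** ?Y))
      + (?k * ?k) *\<^sub>R (?X ** (?P ** ?Y ** ?P) + ?X ** ((?P ** ?P) ** ?Y)
          + (?P ** ?X ** ?Y) ** ?P + (?P ** ?X ** ?P) ** ?Y)"
    by (simp add: Q_def matrix_ring_simps scaleR_add_right algebra_simps)
  have tr: "trace (c *\<^sub>R Z) = c * trace Z" "trace (0 :: real^'n^'n) = 0" for c and Z :: "real^'n^'n"
    by (simp_all add: trace_def sum_distrib_left)
  have 1: "trace ((?X ** ?Y) ** ?P) = trace (?P ** (?X ** ?Y))"
    by (rule trace_mul_sym)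
  have 2: "trace (?X ** (?P ** ?Y)) = trace (?P ** (?X ** ?Y))"
    by (subst trace_mul_sym) (simp add: trace_P_commute[of r s i j] flip: matrix_mul_assoc)
  have 3: "trace ((?P ** ?X ** ?Y) ** ?P) = \<sigma> x y * trace (?P ** (?X ** ?Y))"
  proof -
    have "trace ((?P ** ?X ** ?Y) ** ?P) = trace ((?P ** ?P) ** (?X ** ?Y))"
      by (subst trace_mul_sym) (simp add: matrix_mul_assoc)
    then show ?thesis by (simp add: P_P tr matrix_scaleR_left)
  qed
  have 4: "trace (?X ** ((?P ** ?P) ** ?Y)) = \<sigma> x y * trace (?P ** (?X ** ?Y))"
    by (simp add: P_P tr matrix_scaleR_left matrix_scaleR_right 2)
  have 5: "?X ** (0 :: real^'n^'n) = 0" "(0 :: real^'n^'n) ** ?Y = 0"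
    by (simp_all add: matrix_matrix_mult_def vec_eq_iff)
  \<comment> \<open>Completing the square: \<open>2 \<kappa> + \<kappa>^2 \<sigma>\<close> is
    \<open>((1 + \<kappa> \<sigma>)^2 - 1) / \<sigma>\<close>, and
    \<open>1 + \<kappa> \<sigma> = 1 / H\<close>.\<close>
  have k: "2 * (2 * ?k + ?k * ?k * \<sigma> x y) = 2 / \<sigma> x y * (1 / H\<^sup>2 - 1)"
    using H_pos \<sigma>_pos[OF x y] by (simp add: \<kappa>_def field_simps power2_eq_square)
  have "trace (Q r s x y ** Q i j x y) = trace (?X ** ?Y)
      + 2 * (2 * ?k + ?k * ?k * \<sigma> x y) * trace (?P ** (?X ** ?Y))"
    unfolding e P_R_P 5 trace_add tr 1 2 3 4 by (simp add: algebra_simps)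
  then show ?thesis unfolding k .
qed

lemma quadratic_invariant:
  "(\<Sum>k\<in>UNIV. \<Sum>n\<in>UNIV. \<Sum>i\<in>UNIV. \<Sum>j\<in>UNIV. rho_raise F a N k n i j x y * rho_low F N k n i j x y)
    = (\<Sum>k\<in>UNIV. \<Sum>n\<in>UNIV. \<Sum>i\<in>UNIV. \<Sum>j\<in>UNIV.
         riemann_raise4 a k n i j x * riemann_low a k n i j x)
      + 2 / (riemannian_fun a x (t x y))^2 * (1 / H^2 - 1) *
        (\<Sum>l\<in>UNIV. \<Sum>h\<in>UNIV. \<Sum>n\<in>UNIV. \<Sum>i\<in>UNIV. \<Sum>j\<in>UNIV.
           t x y $ l * riemann_raise3 a l n i j x * t x y $ h * riemann_low a h n i j x)"
proof -
  let ?T = "matrix_inv (a x)"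
  \<comment> \<open>All three sums share this contraction of the form indices with the inverse of
    \<open>a\<close>, so the identity reduces to \<open>trace_Q_Q\<close> term by term.\<close>
  let ?C = "\<lambda>f. \<Sum>i\<in>UNIV. \<Sum>j\<in>UNIV. \<Sum>r\<in>UNIV. \<Sum>s\<in>UNIV. ?T $ i $ r * ?T $ j $ s * f i j r s"
  have 1: "(\<Sum>k\<in>UNIV. \<Sum>n\<in>UNIV. \<Sum>i\<in>UNIV. \<Sum>j\<in>UNIV. rho_raise F a N k n i j x y * rho_low F N k n i j x y)
    = ?C (\<lambda>i j r s. - trace (Q r s x y ** Q i j x y))"
    using contraction_eq_trace[of "matrix_inv (G x y)" ?T "\<lambda>i j. rho_low_mat i j x y"]
    unfolding rho_trace by (simp add: rho_raise_def rho_low_mat_def)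
  have r4: "riemann_raise4 a k n i j x = (\<Sum>p\<in>UNIV. \<Sum>q\<in>UNIV. \<Sum>r\<in>UNIV. \<Sum>s\<in>UNIV.
      ?T $ k $ p * ?T $ n $ q * ?T $ i $ r * ?T $ j $ s * riemann_low_mat r s x $ p $ q)" for k n i j
    by (simp add: riemann_raise4_def riemann_raise3_def riemann_low_mat_def sum_distrib_left mult.assoc)
  have 2: "(\<Sum>k\<in>UNIV. \<Sum>n\<in>UNIV. \<Sum>i\<in>UNIV. \<Sum>j\<in>UNIV. riemann_raise4 a k n i j x * riemann_low a k n i j x)
    = ?C (\<lambda>i j r s. - trace (R r s x ** R i j x))"
    using contraction_eq_trace[of ?T ?T "\<lambda>i j. riemann_low_mat i j x"]
    unfolding riemann_trace r4[symmetric] by (simp add: riemann_low_mat_def)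
  have 3: "(\<Sum>l\<in>UNIV. \<Sum>h\<in>UNIV. \<Sum>n\<in>UNIV. \<Sum>i\<in>UNIV. \<Sum>j\<in>UNIV.
           t x y $ l * riemann_raise3 a l n i j x * t x y $ h * riemann_low a h n i j x)
    = ?C (\<lambda>i j r s. - trace (P x y ** (R r s x ** R i j x)))"
    using vector_contraction_eq[of "t x y" ?T "\<lambda>i j. riemann_low_mat i j x"]
    unfolding t_R_R_t by (simp add: riemann_low_mat_def riemann_raise3_def)
  have 4: "(riemannian_fun a x (t x y))\<^sup>2 = \<sigma> x y"
  proof -
    have "(\<Sum>i\<in>UNIV. \<Sum>j\<in>UNIV. a x $ i $ j * t x y $ i * t x y $ j) = \<sigma> x y"
      by (simp add: \<sigma>_def inner_vec_def matrix_vector_mult_def sum_distrib_left mult_ac)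
    then show ?thesis using \<sigma>_pos[OF x y] by (simp add: riemannian_fun_def)
  qed
  show ?thesis
    unfolding 1 2 3 4 trace_Q_Q sum_distrib_left sum.distrib[symmetric]
    by (intro sum.cong refl) (simp add: algebra_simps)
qed

end

section \<open>Return from matrices to index notation\<close>

lemma curvature_M: "x \<in> U \<Longrightarrow> y \<noteq> 0 \<Longrightarrow> M_curv N n i j x y =
    - (\<Sum>r\<in>UNIV. \<Sum>h\<in>UNIV. jac_inv t n r x y * t x y $ h * riemann_curv a h r i j x)"
  using arg_cong[OF M_eq[of x y i j], of "\<lambda>v. v $ n"]
  by (simp add: M_vec_def B_def riemann_mat_def matrix_vector_mult_def sum_distrib_left mult_ac)

lemma curvature_rho:
  assumes "x \<in> U" "y \<noteq> 0"
  shows "rho_curv F N k n i j x y = - (1 - H) * (1 / F x y) *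
      (\<Sum>m\<in>UNIV. (unit_covec F k x y * (if n = m then 1 else 0)
         - unit_vec F n x y * metric_tensor F x y $ m $ k) * M_curv N m i j x y)
    + (\<Sum>m\<in>UNIV. \<Sum>h\<in>UNIV. jac_inv t n m x y * riemann_curv a h m i j x * jac t h k x y)"
proof -
  have 1: "rho_curv F N k n i j x y = column k (rho_mat i j x y) $ n"
    by (simp add: column_def rho_mat_def)
  have 2: "(B x y *v (R i j x *v column k (J x y))) $ n
    = (\<Sum>m\<in>UNIV. \<Sum>h\<in>UNIV. jac_inv t n m x y * riemann_curv a h m i j x * jac t h k x y)"
    by (simp add: B_def J_def riemann_mat_def column_def matrix_vector_mult_def sum_distrib_left mult_ac)
  have 3: "(\<Sum>m\<in>UNIV. (unit_covec F k x y * (if n = m then 1 else 0)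
         - unit_vec F n x y * metric_tensor F x y $ m $ k) * M_curv N m i j x y)
    = covec x y $ k * M_vec i j x y $ n - y $ n / F x y * (G x y *v M_vec i j x y) $ k"
    by (simp add: left_diff_distrib sum_subtractf covec_def M_vec_def unit_vec_def
        matrix_vector_mult_def sum_distrib_left G_sym[OF assms, of k] mult.assoc
        if_distrib[of "\<lambda>c. _ * c"] if_distrib[of "\<lambda>c. c * _"] cong: if_cong)
  show ?thesis
    unfolding 1 3 rho_column[OF assms] 2[symmetric] using F_pos[OF assms]
    by (simp add: q_def power2_eq_square field_simps)
qed

end

theorem mainTheorem9:
  fixes U :: "(real^'n) set"
    and F :: "real^'n \<Rightarrow> real^'n \<Rightarrow> real"
    and a :: "real^'n \<Rightarrow> real^'n^'n"
    and t :: "real^'n \<Rightarrow> real^'n \<Rightarrow> real^'n"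
    and H :: real
    and N :: "'n \<Rightarrow> 'n \<Rightarrow> real^'n \<Rightarrow> real^'n \<Rightarrow> real"
    and M :: "'n \<Rightarrow> 'n \<Rightarrow> 'n \<Rightarrow> real^'n \<Rightarrow> real^'n \<Rightarrow> real"
    and \<rho> \<rho>L :: "'n \<Rightarrow> 'n \<Rightarrow> 'n \<Rightarrow> 'n \<Rightarrow> real^'n \<Rightarrow> real^'n \<Rightarrow> real"
  assumes dim: "CARD('n) \<ge> 3"
    and U: "open U"
    and finsler: "finsler_metric U F"
    and riem: "riemannian_metric U a"
    and autom: "conformal_automorphism U F a H t"
    and N: "N = autom_conn a t"
    and M: "M = M_curv N"
    and \<rho>: "\<rho> = rho_curv F N"
    and \<rho>L: "\<rho>L = rho_low F N"
  shows "\<forall>x\<in>U. \<forall>y. y \<noteq> 0 \<longrightarrow>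
      (\<forall>n i j. M n i j x y =
         - (\<Sum>r\<in>UNIV. \<Sum>h\<in>UNIV. jac_inv t n r x y * t x y $ h * riemann_curv a h r i j x))
    \<and> (\<forall>k n i j. \<rho> k n i j x y =
         - (1 - H) * (1 / F x y) *
           (\<Sum>m\<in>UNIV. (unit_covec F k x y * (if n = m then 1 else 0)
                        - unit_vec F n x y * metric_tensor F x y $ m $ k) * M m i j x y)
         + (\<Sum>m\<in>UNIV. \<Sum>h\<in>UNIV. jac_inv t n m x y * riemann_curv a h m i j x * jac t h k x y))
    \<and> (\<forall>m n i j. \<rho>L m n i j x y = - \<rho>L n m i j x y \<and> \<rho>L m n i j x y = - \<rho>L m n j i x y)
    \<and> (\<forall>k n i j l. cov_deriv a N l \<rho> k n i j x y + cov_deriv a N j \<rho> k n l i x y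
         + cov_deriv a N i \<rho> k n j l x y = 0)
    \<and> (\<Sum>k\<in>UNIV. \<Sum>n\<in>UNIV. \<Sum>i\<in>UNIV. \<Sum>j\<in>UNIV. rho_raise F a N k n i j x y * \<rho>L k n i j x y)
      = (\<Sum>k\<in>UNIV. \<Sum>n\<in>UNIV. \<Sum>i\<in>UNIV. \<Sum>j\<in>UNIV.
           riemann_raise4 a k n i j x * riemann_low a k n i j x)
        + 2 / (riemannian_fun a x (t x y))^2 * (1 / H^2 - 1) *
          (\<Sum>l\<in>UNIV. \<Sum>h\<in>UNIV. \<Sum>n\<in>UNIV. \<Sum>i\<in>UNIV. \<Sum>j\<in>UNIV.
             t x y $ l * riemann_raise3 a l n i j x * t x y $ h * riemann_low a h n i j x)"
proof -
  interpret conformal_calculus U a F H t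
    by unfold_locales (rule U riem finsler autom)+
  show ?thesis
    unfolding M \<rho> \<rho>L N
    by (intro ballI allI impI conjI curvature_M curvature_rho rho_low_skew cyclic_identity
        quadratic_invariant)
qed

end
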